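(* Let $q \geq 3$ be a prime power and let $c$ be an integer with $2 \leq c < q$. Then there exists a quantum code with parameters $[[q^{2}-1,\; q^{2}-4c+5,\; d \geq c]]_{q}$.
   Context: An $[[n,K,d]]_q$ quantum code is a $q^{K}$-dimensional complex subspace $Q$ of $(\mathbb{C}^{q})^{\otimes n}$ with minimum distance $d$; "$d\geq c$" means that the minimum distance is at least $c$, i.e. every error operator $E$ acting nontrivially on at most $c-1$ of the $n$ tensor factors is detectable: $PEP=\lambda_E P$ for some scalar $\lambda_E$, where $P$ is the orthogonal projector onto $Q$. *)

theory Defs
  imports
    Complex_Main
    "HOL-Library.FuncSet"
    "HOL-Library.Function_Algebras"
    "HOL-Number_Theory.Prime_Powers"
begin

text \<open>
  The space \<open>(\<complex>\<^sup>q)\<^sup>\<otimes>\<^sup>n\<close> is represented by coordinates with respect to the product basis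
  \<open>|x\<^sub>0\<rangle> \<otimes> \<dots> \<otimes> |x\<^bsub>n-1\<^esub>\<rangle>\<close>, whose index set is \<open>{0..<q}\<^sup>n\<close>.
\<close>

type_synonym qword = "nat \<Rightarrow> nat"
type_synonym qstate = "qword \<Rightarrow> complex"

definition qscale :: "complex \<Rightarrow> qstate \<Rightarrow> qstate" where
  "qscale a \<psi> = (\<lambda>x. a * \<psi> x)"

interpretation qvec: vector_space qscale
  by unfold_locales (auto simp: qscale_def fun_eq_iff algebra_simps)

definition qwords :: "nat \<Rightarrow> nat \<Rightarrow> qword set" where
  "qwords q n = {..<n} \<rightarrow>\<^sub>E {..<q}"

definition tensor_space :: "nat \<Rightarrow> nat \<Rightarrow> qstate set" where
  "tensor_space q n = {\<psi>. \<forall>x. x \<notin> qwords q n \<longrightarrow> \<psi> x = 0}"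

definition ket :: "qword \<Rightarrow> qstate" where
  "ket x = (\<lambda>y. if y = x then 1 else 0)"

definition qinner :: "nat \<Rightarrow> nat \<Rightarrow> qstate \<Rightarrow> qstate \<Rightarrow> complex" where
  "qinner q n \<phi> \<psi> = (\<Sum>x\<in>qwords q n. cnj (\<phi> x) * \<psi> x)"

text \<open>Linear operators on \<open>(\<complex>\<^sup>q)\<^sup>\<otimes>\<^sup>n\<close>; values outside the space are irrelevant.\<close>

definition qoperator :: "nat \<Rightarrow> nat \<Rightarrow> (qstate \<Rightarrow> qstate) \<Rightarrow> bool" where
  "qoperator q n T \<longleftrightarrow>
     (\<forall>\<psi>\<in>tensor_space q n. T \<psi> \<in> tensor_space q n) \<and>
     (\<forall>\<psi>\<in>tensor_space q n. \<forall>\<phi>\<in>tensor_space q n. T (\<psi> + \<phi>) = T \<psi> + T \<phi>) \<and>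
     (\<forall>a. \<forall>\<psi>\<in>tensor_space q n. T (qscale a \<psi>) = qscale a (T \<psi>))"

text \<open>
  \<open>T\<close> acts as the identity on all tensor factors outside \<open>S\<close>, that is, \<open>T = A \<otimes> id\<close>
  where \<open>A\<close> is an operator on the factors in \<open>S\<close>, given by its matrix entries.
\<close>

definition acts_only_on :: "nat \<Rightarrow> nat \<Rightarrow> nat set \<Rightarrow> (qstate \<Rightarrow> qstate) \<Rightarrow> bool" where
  "acts_only_on q n S T \<longleftrightarrow>
     qoperator q n T \<and>
     (\<exists>A :: qword \<Rightarrow> qword \<Rightarrow> complex. \<forall>x\<in>qwords q n. \<forall>y\<in>qwords q n.
        T (ket y) x =
          (if \<forall>i\<in>{..<n} - S. x i = y i then A (restrict x S) (restrict y S) else 0))"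

definition orth_projector :: "nat \<Rightarrow> nat \<Rightarrow> qstate set \<Rightarrow> (qstate \<Rightarrow> qstate) \<Rightarrow> bool" where
  "orth_projector q n Q P \<longleftrightarrow>
     (\<forall>\<psi>\<in>tensor_space q n. P \<psi> \<in> Q \<and> (\<forall>\<phi>\<in>Q. qinner q n \<phi> (\<psi> - P \<psi>) = 0))"

definition detectable :: "nat \<Rightarrow> nat \<Rightarrow> (qstate \<Rightarrow> qstate) \<Rightarrow> (qstate \<Rightarrow> qstate) \<Rightarrow> bool" where
  "detectable q n P E \<longleftrightarrow>
     (\<exists>l :: complex. \<forall>\<psi>\<in>tensor_space q n. P (E (P \<psi>)) = qscale l (P \<psi>))"

text \<open>The orthogonal projector onto a subspace exists and is unique on \<open>tensor_space q n\<close>.\<close>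

definition min_distance_ge :: "nat \<Rightarrow> nat \<Rightarrow> qstate set \<Rightarrow> nat \<Rightarrow> bool" where
  "min_distance_ge q n Q c \<longleftrightarrow>
     (\<exists>P. orth_projector q n Q P \<and>
        (\<forall>S E. S \<subseteq> {..<n} \<and> card S < c \<and> acts_only_on q n S E \<longrightarrow> detectable q n P E))"

text \<open>\<open>Q\<close> is an \<open>[[n, K, d \<ge> c]]\<^sub>q\<close> code: as \<open>K\<close> is a base-\<open>q\<close> logarithm, the dimension is \<open>q ^ K\<close>.\<close>

definition quantum_code :: "nat \<Rightarrow> nat \<Rightarrow> nat \<Rightarrow> nat \<Rightarrow> qstate set \<Rightarrow> bool" where
  "quantum_code q n K c Q \<longleftrightarrow>
     qvec.subspace Q \<and> Q \<subseteq> tensor_space q n \<and> qvec.dim Q = q ^ K \<and> min_distance_ge q n Q c"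

end

(*
Let F be the field with q^2 elements, Tr a = a + a^q, and let the coordinates be
indexed by the nonzero elements x of F.  Let D consist of the words (Tr f(x)) with deg f \<le> c - 2.
The sums sum_x x^(q+1+k) Tr f(x) with k \<le> c - 2 only involve powers x^m with 0 < m < q^2 - 1, so
they vanish and D is contained in its dual C for the weights x^(q+1).  The quantum code consists of the functions
on C that are constant on the cosets of D.

A polynomial of degree at most c - 2 can be prescribed at any c - 1 points and Tr is onto.  Hence
two words of C that agree outside fewer than c positions are equal, and on fewer than c positions
every coset of D is uniformly distributed; these two facts give the Knill--Laflamme conditions
without any use of characters.  Power sums recover Tr f(0) and the other coefficients of f from
(Tr f(x)), so D has q^(2c-3) elements, and likewise C has index q^(2c-3) in the space of all words.

As q varies there is no type of field elements.  F is replaced by congruences modulo a prime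
ideal of Z[X] lying above p and above the kernel of evaluation at a primitive (q^2 - 1)-th
complex root of unity zeta; its nonzero residues are the powers of X, since a sum of powers of
zeta^d over a full period is 0 or q^2 - 1 already in the complex numbers.
*)
theory Submission
  imports Defs "Jordan_Normal_Form.Char_Poly"
begin

section \<open>Codes spanned by coset states\<close>

lemma sum_fun_apply: "(\<Sum>v\<in>A. f v) x = (\<Sum>v\<in>A. (f v x :: 'b :: comm_monoid_add))"
  by (induction A rule: infinite_finite_induct) auto

lemma finite_qwords [simp]: "finite (qwords q n)"
  unfolding qwords_def by (intro finite_PiE) auto

lemma ket_in_tensor_space: "y \<in> qwords q n \<Longrightarrow> ket y \<in> tensor_space q n"
  by (auto simp: ket_def tensor_space_def)

lemma sum_in_tensor_space:
  "(\<And>x. x \<in> A \<Longrightarrow> f x \<in> tensor_space q n) \<Longrightarrow> sum f A \<in> tensor_space q n"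
  by (induction A rule: infinite_finite_induct) (auto simp: tensor_space_def)

lemma qscale_in_tensor_space: "\<psi> \<in> tensor_space q n \<Longrightarrow> qscale a \<psi> \<in> tensor_space q n"
  by (auto simp: tensor_space_def qscale_def)

lemma ket_expansion:
  assumes "\<psi> \<in> tensor_space q n"
  shows "\<psi> = (\<Sum>y\<in>qwords q n. qscale (\<psi> y) (ket y))"
proof
  fix x
  have "(\<Sum>y\<in>qwords q n. qscale (\<psi> y) (ket y)) x
      = (\<Sum>y\<in>qwords q n. if x = y then \<psi> y else 0)"
    unfolding sum_fun_apply qscale_def ket_def by (intro sum.cong) auto
  also have "\<dots> = \<psi> x"
    using assms by (auto simp: tensor_space_def)
  finally show "\<psi> x = (\<Sum>y\<in>qwords q n. qscale (\<psi> y) (ket y)) x" by simp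
qed

lemma qoperator_sum:
  assumes T: "qoperator q n T" and f: "\<And>x. x \<in> A \<Longrightarrow> f x \<in> tensor_space q n"
  shows "T (sum f A) = (\<Sum>x\<in>A. T (f x))"
proof -
  have "(0::qstate) \<in> tensor_space q n" by (simp add: tensor_space_def)
  then have "T (qscale 0 0) = qscale 0 (T 0)" using T unfolding qoperator_def by blast
  then have T0: "T 0 = 0" by simp
  show ?thesis
    using f
  proof (induction A rule: infinite_finite_induct)
    case (insert x A)
    have "T (f x + sum f A) = T (f x) + T (sum f A)"
      using T insert.prems sum_in_tensor_space[of A f q n] unfolding qoperator_def by blast
    moreover have "T (sum f A) = (\<Sum>x\<in>A. T (f x))" using insert by blast
    ultimately show ?case by (simp only: sum.insert[OF insert.hyps])
  qed (use T0 in auto)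
qed

text \<open>Linearity reduces an operator to its matrix entries, in terms of which
  \<open>acts_only_on\<close> describes a local error.\<close>

lemma qoperator_expansion:
  assumes T: "qoperator q n T" and \<psi>: "\<psi> \<in> tensor_space q n"
  shows "T \<psi> x = (\<Sum>y\<in>qwords q n. \<psi> y * T (ket y) x)"
proof -
  have "T \<psi> = (\<Sum>y\<in>qwords q n. T (qscale (\<psi> y) (ket y)))"
    by (subst ket_expansion[OF \<psi>], rule qoperator_sum[OF T])
      (auto intro: qscale_in_tensor_space ket_in_tensor_space)
  also have "\<dots> = (\<Sum>y\<in>qwords q n. qscale (\<psi> y) (T (ket y)))"
    using T by (intro sum.cong) (auto simp: qoperator_def ket_in_tensor_space)
  finally show ?thesis by (simp add: sum_fun_apply qscale_def)
qed

section \<open>Coset states and their projector\<close>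

lemma card_eq_card_quotient_times:
  assumes "finite C" "equiv C r" "\<And>x. x \<in> C \<Longrightarrow> card (r `` {x}) = m"
  shows "card C = m * card (C // r)"
proof -
  have "m * card (C // r) = card (\<Union> (C // r))"
  proof (rule card_partition)
    show "finite (C // r)" "finite (\<Union> (C // r))"
      using assms by (auto simp: finite_quotient equiv_type Union_quotient)
    show "card c = m" if "c \<in> C // r" for c
      using that assms by (auto elim!: quotientE)
    show "c1 \<inter> c2 = {}" if "c1 \<in> C // r" "c2 \<in> C // r" "c1 \<noteq> c2" for c1 c2
      using that quotient_disj[OF assms(2)] by blast
  qed
  then show ?thesis using assms by (simp add: Union_quotient)
qed

text \<open>For a linear code \<open>C\<close> and congruence \<open>r\<close> modulo a subcode this
  is the CSS code space, spanned by the uniform superpositions over the cosets.\<close>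

definition coset_states :: "qword set \<Rightarrow> qword rel \<Rightarrow> qstate set" where
  "coset_states C r =
     {\<psi>. (\<forall>x. x \<notin> C \<longrightarrow> \<psi> x = 0) \<and> (\<forall>x y. (x, y) \<in> r \<longrightarrow> \<psi> x = \<psi> y)}"

lemma subspace_coset_states: "qvec.subspace (coset_states C r)"
  unfolding qvec.subspace_def by (auto simp: coset_states_def qscale_def)

text \<open>The indicator functions of the classes form a basis: they span because a state is
  constant on each class, and they are independent because the classes are disjoint and
  nonempty.\<close>

lemma dim_coset_states:
  assumes C: "finite C" and r: "equiv C r"
  shows "qvec.dim (coset_states C r) = card (C // r)"
proof -
  define e :: "qword set \<Rightarrow> qstate" where "e X = (\<lambda>x. if x \<in> X then 1 else 0)" for X
  have inj: "inj_on e A" for A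
    by (rule inj_onI) (auto simp: e_def fun_eq_iff split: if_splits)
  have fin: "finite (C // r)" using C r by (simp add: finite_quotient equiv_type)
  have e_at: "e Y x = (if Y = X then 1 else 0)" if "X \<in> C // r" "Y \<in> C // r" "x \<in> X" for X Y x
    using that quotient_disj[OF r that(1,2)] by (auto simp: e_def)
  have "qvec.dim (coset_states C r) = card (e ` (C // r))"
  proof (rule qvec.dim_unique[OF _ _ _ refl])
    show "e ` (C // r) \<subseteq> coset_states C r"
    proof clarify
      fix X assume X: "X \<in> C // r"
      have "X \<subseteq> C" using X r by (simp add: in_quotient_imp_subset)
      moreover have "x \<in> X \<longleftrightarrow> y \<in> X" if "(x, y) \<in> r" for x y
        using that X r by (meson in_quotient_imp_closed equiv_def symE)
      ultimately show "e X \<in> coset_states C r" by (auto simp: coset_states_def e_def)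
    qed
    show "coset_states C r \<subseteq> qvec.span (e ` (C // r))"
    proof
      fix \<psi> assume \<psi>: "\<psi> \<in> coset_states C r"
      have "\<psi> = (\<Sum>X\<in>C // r. qscale (\<psi> (SOME x. x \<in> X)) (e X))"
      proof
        fix x
        show "\<psi> x = (\<Sum>X\<in>C // r. qscale (\<psi> (SOME x. x \<in> X)) (e X)) x"
        proof (cases "x \<in> C")
          case True
          then have X: "r `` {x} \<in> C // r" "x \<in> r `` {x}"
            using equiv_class_self[OF r] by (auto intro: quotientI)
          have "(\<Sum>X\<in>C // r. qscale (\<psi> (SOME x. x \<in> X)) (e X)) x
              = (\<Sum>X\<in>C // r. if X = r `` {x} then \<psi> (SOME x. x \<in> X) else 0)"
            unfolding sum_fun_apply qscale_def by (intro sum.cong refl) (simp add: e_at[OF X(1) _ X(2)])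
          also have "\<dots> = \<psi> (SOME y. y \<in> r `` {x})" using X fin by simp
          also have "(SOME y. y \<in> r `` {x}) \<in> r `` {x}" using X(2) by (rule someI[of "\<lambda>y. y \<in> r `` {x}"])
          then have "\<psi> (SOME y. y \<in> r `` {x}) = \<psi> x" using \<psi> by (auto simp: coset_states_def)
          finally show ?thesis by simp
        next
          case False
          then have "e X x = 0" if "X \<in> C // r" for X
            using that in_quotient_imp_subset[OF r that] by (auto simp: e_def)
          then show ?thesis using False \<psi> by (simp add: sum_fun_apply qscale_def coset_states_def)
        qed
      qed
      also have "\<dots> \<in> qvec.span (e ` (C // r))"
        by (intro qvec.span_sum qvec.span_scale qvec.span_base) auto
      finally show "\<psi> \<in> qvec.span (e ` (C // r))" .
    qed
    show "qvec.independent (e ` (C // r))"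
    proof -
      have "u (e X) = 0" if *: "(\<Sum>v\<in>e ` (C // r). qscale (u v) v) = 0" and X: "X \<in> C // r" for u X
      proof -
        obtain x where x: "x \<in> X" using X r in_quotient_imp_non_empty by blast
        have "0 = (\<Sum>v\<in>e ` (C // r). qscale (u v) v) x" using * by simp
        also have "\<dots> = (\<Sum>Y\<in>C // r. qscale (u (e Y)) (e Y) x)"
          by (simp add: sum_fun_apply sum.reindex[OF inj])
        also have "\<dots> = (\<Sum>Y\<in>C // r. if Y = X then u (e Y) else 0)"
          unfolding qscale_def by (intro sum.cong refl) (simp add: e_at[OF X _ x])
        also have "\<dots> = u (e X)" using X fin by simp
        finally show ?thesis by simp
      qed
      then show ?thesis using fin by (auto simp: qvec.dependent_finite)
    qed
  qed
  then show ?thesis by (simp add: card_image inj)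
qed

definition coset_average :: "qword set \<Rightarrow> qword rel \<Rightarrow> qstate \<Rightarrow> qstate" where
  "coset_average C r \<psi> =
     (\<lambda>x. if x \<in> C then (\<Sum>y\<in>r `` {x}. \<psi> y) / of_nat (card (r `` {x})) else 0)"

lemma coset_average_in_coset_states:
  assumes "equiv C r"
  shows "coset_average C r \<psi> \<in> coset_states C r"
proof -
  have "r `` {x} = r `` {y}" "x \<in> C \<longleftrightarrow> y \<in> C" if "(x, y) \<in> r" for x y
    using that equiv_class_eq[OF assms that] assms by (auto simp: equiv_class_eq_iff)
  then show ?thesis by (auto simp: coset_states_def coset_average_def)
qed

text \<open>On each class a state of the code is constant, and the deviation of \<psi> from its
  class average sums to 0; so the inner product vanishes class by class.\<close>

lemma orth_projector_coset_average:
  assumes C: "C \<subseteq> qwords q n" and r: "equiv C r"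
  shows "orth_projector q n (coset_states C r) (coset_average C r)"
proof -
  have finC: "finite C" using finite_subset[OF C] by simp
  have fin: "finite X" if "X \<in> C // r" for X
    using that finC in_quotient_imp_subset[OF r] finite_subset by blast
  have "qinner q n \<phi> (\<psi> - coset_average C r \<psi>) = 0" if \<phi>: "\<phi> \<in> coset_states C r" for \<phi> \<psi>
  proof -
    let ?f = "\<lambda>x. cnj (\<phi> x) * (\<psi> - coset_average C r \<psi>) x"
    have "qinner q n \<phi> (\<psi> - coset_average C r \<psi>) = sum ?f C"
      unfolding qinner_def using \<phi> C
      by (intro sum.mono_neutral_right) (auto simp: coset_states_def)
    also have "\<dots> = sum ?f (\<Union> (C // r))" using r by (simp add: Union_quotient)
    also have "\<dots> = (\<Sum>X\<in>C // r. sum ?f X)"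
      using fin quotient_disj[OF r] by (subst sum.Union_disjoint) auto
    also have "\<dots> = 0"
    proof (rule sum.neutral, rule ballI)
      fix X assume X: "X \<in> C // r"
      then obtain x where x: "x \<in> C" "X = r `` {x}" by (auto elim: quotientE)
      have xX: "x \<in> X" using x equiv_class_self[OF r] by auto
      have av: "coset_average C r \<psi> y = sum \<psi> X / of_nat (card X)" and ph: "\<phi> y = \<phi> x"
        if "y \<in> X" for y
      proof -
        have xy: "(x, y) \<in> r" using that x by auto
        then have "y \<in> C" using r by (simp add: equiv_class_eq_iff)
        moreover have "r `` {y} = X" using equiv_class_eq[OF r xy] x by simp
        ultimately show "coset_average C r \<psi> y = sum \<psi> X / of_nat (card X)"
          by (simp add: coset_average_def)
        show "\<phi> y = \<phi> x" using xy \<phi> by (auto simp: coset_states_def)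
      qed
      have "sum ?f X = cnj (\<phi> x) * (\<Sum>y\<in>X. \<psi> y - sum \<psi> X / of_nat (card X))"
        unfolding sum_distrib_left by (intro sum.cong refl) (simp add: av ph)
      also have "(\<Sum>y\<in>X. \<psi> y - sum \<psi> X / of_nat (card X)) = 0"
        using fin[OF X] xX by (auto simp: sum_subtractf)
      finally show "sum ?f X = 0" by simp
    qed
    finally show ?thesis .
  qed
  then show ?thesis
    using coset_average_in_coset_states[OF r] by (auto simp: orth_projector_def)
qed

text \<open>The two Knill--Laflamme conditions: \<open>sep\<close> makes a local error diagonal on the support
  \<open>C\<close>, and \<open>unif\<close> makes the average of its diagonal over a coset independent of the coset.\<close>

lemma coset_quantum_code:
  assumes C: "C \<subseteq> qwords q n" and r: "equiv C r"
    and sep: "\<And>S x y. \<lbrakk>S \<subseteq> {..<n}; card S < c; x \<in> C; y \<in> C; \<forall>i\<in>{..<n} - S. x i = y i\<rbrakk> \<Longrightarrow> x = y"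
    and unif: "\<And>S. \<lbrakk>S \<subseteq> {..<n}; card S < c\<rbrakk> \<Longrightarrow>
       \<exists>\<mu>. \<forall>x\<in>C. \<forall>w\<in>S \<rightarrow>\<^sub>E {..<q}. card {y \<in> r `` {x}. restrict y S = w} = \<mu>"
    and m: "\<And>x. x \<in> C \<Longrightarrow> card (r `` {x}) = m"
    and dim: "card (C // r) = q ^ K"
  shows "quantum_code q n K c (coset_states C r)"
  unfolding quantum_code_def min_distance_ge_def
proof (intro conjI exI allI impI)
  have finC: "finite C" using finite_subset[OF C] by simp
  show "qvec.subspace (coset_states C r)" by (rule subspace_coset_states)
  show sub: "coset_states C r \<subseteq> tensor_space q n"
    using C by (auto simp: coset_states_def tensor_space_def)
  show "qvec.dim (coset_states C r) = q ^ K" using dim_coset_states[OF finC r] dim by simp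
  show "orth_projector q n (coset_states C r) (coset_average C r)"
    by (rule orth_projector_coset_average[OF C r])
  fix S E assume SE: "S \<subseteq> {..<n} \<and> card S < c \<and> acts_only_on q n S E"
  then have S: "S \<subseteq> {..<n}" "card S < c" and E: "qoperator q n E"
    by (auto simp: acts_only_on_def)
  have finS: "finite S" using S(1) finite_subset by auto
  obtain A where A: "\<And>x y. x \<in> qwords q n \<Longrightarrow> y \<in> qwords q n \<Longrightarrow>
      E (ket y) x = (if \<forall>i\<in>{..<n} - S. x i = y i then A (restrict x S) (restrict y S) else 0)"
    using SE unfolding acts_only_on_def by blast
  obtain \<mu> where \<mu>: "\<And>x w. x \<in> C \<Longrightarrow> w \<in> S \<rightarrow>\<^sub>E {..<q} \<Longrightarrow>
      card {y \<in> r `` {x}. restrict y S = w} = \<mu>"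
    using unif[OF S] by blast
  \<comment> \<open>The mean of the diagonal entries \<open>A w w\<close> over a class, in which
    each restriction \<open>w\<close> occurs \<open>\<mu>\<close> times among \<open>m\<close>
    words.\<close>
  define l :: complex where "l = (\<Sum>w\<in>S \<rightarrow>\<^sub>E {..<q}. of_nat \<mu> * A w w) / of_nat m"
  \<comment> \<open>A nonzero entry of \<open>E\<close> between \<open>y\<close> and
    \<open>w\<close> forces agreement outside \<open>S\<close>. Then either \<open>w\<close> lies
    outside \<open>C\<close>, where \<chi> is 0, or \<open>sep\<close> gives
    \<open>w = y\<close>.\<close>
  have diag: "E \<chi> y = \<chi> y * A (restrict y S) (restrict y S)"
    if \<chi>: "\<chi> \<in> coset_states C r" and y: "y \<in> C" for \<chi> y
  proof -
    have "E \<chi> y = (\<Sum>w\<in>qwords q n. \<chi> w * E (ket w) y)"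
      using \<chi> sub by (intro qoperator_expansion[OF E]) blast
    also have "\<dots> = (\<Sum>w\<in>qwords q n. if w = y then \<chi> y * A (restrict y S) (restrict y S) else 0)"
    proof (intro sum.cong refl)
      fix w assume w: "w \<in> qwords q n"
      have Ew: "E (ket w) y =
          (if \<forall>i\<in>{..<n} - S. y i = w i then A (restrict y S) (restrict w S) else 0)"
        using A w y C by blast
      show "\<chi> w * E (ket w) y = (if w = y then \<chi> y * A (restrict y S) (restrict y S) else 0)"
      proof (cases "w \<in> C \<and> (\<forall>i\<in>{..<n} - S. y i = w i)")
        case True
        then have "w = y" using sep[OF S y, of w] by simp
        then show ?thesis using Ew by simp
      next
        case False
        then have "\<chi> w * E (ket w) y = 0" using Ew \<chi> by (auto simp: coset_states_def)
        moreover have "w \<noteq> y" using False y by auto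
        ultimately show ?thesis by simp
      qed
    qed
    finally show ?thesis using y C by auto
  qed
  have "coset_average C r (E \<chi>) = qscale l \<chi>" if \<chi>: "\<chi> \<in> coset_states C r" for \<chi>
  proof
    fix x
    show "coset_average C r (E \<chi>) x = qscale l \<chi> x"
    proof (cases "x \<in> C")
      case True
      define X where "X = r `` {x}"
      have XC: "X \<subseteq> C" using True r in_quotient_imp_subset[OF r quotientI] by (auto simp: X_def)
      then have finX: "finite X" using finC finite_subset by blast
      have into: "(\<lambda>y. restrict y S) ` X \<subseteq> S \<rightarrow>\<^sub>E {..<q}"
        using XC C S by (fastforce simp: qwords_def PiE_iff)
      have "(\<Sum>y\<in>X. E \<chi> y) = (\<Sum>y\<in>X. \<chi> x * A (restrict y S) (restrict y S))"
        using XC diag[OF \<chi>] \<chi> by (intro sum.cong) (auto simp: X_def coset_states_def)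
      also have "\<dots> = \<chi> x * (\<Sum>y\<in>X. A (restrict y S) (restrict y S))"
        by (simp add: sum_distrib_left)
      \<comment> \<open>Sorting the words of the class by their restriction to \<open>S\<close>
        makes the sum the same for every class.\<close>
      also have "(\<Sum>y\<in>X. A (restrict y S) (restrict y S))
          = (\<Sum>w\<in>S \<rightarrow>\<^sub>E {..<q}. \<Sum>y\<in>{y \<in> X. restrict y S = w}. A (restrict y S) (restrict y S))"
        using into finX finS by (intro sum.group[symmetric]) (auto intro: finite_PiE)
      also have "\<dots> = (\<Sum>w\<in>S \<rightarrow>\<^sub>E {..<q}. of_nat \<mu> * A w w)"
        using \<mu>[OF True] by (intro sum.cong) (auto simp: X_def)
      finally show ?thesis
        using True m[OF True] by (simp add: coset_average_def X_def l_def qscale_def)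
    next
      case False
      then show ?thesis using \<chi> by (simp add: coset_average_def qscale_def coset_states_def)
    qed
  qed
  then show "detectable q n (coset_average C r) E"
    using coset_average_in_coset_states[OF r] by (auto simp: detectable_def)
qed

section \<open>Residues modulo a prime ideal\<close>

locale prime_ideal =
  fixes M :: "'a::comm_ring_1 set"
  assumes zero_mem: "0 \<in> M"
    and add_mem: "\<lbrakk>a \<in> M; b \<in> M\<rbrakk> \<Longrightarrow> a + b \<in> M"
    and mult_mem: "a \<in> M \<Longrightarrow> r * a \<in> M"
    and one_notin: "1 \<notin> M"
    and prime: "a * b \<in> M \<Longrightarrow> a \<in> M \<or> b \<in> M"
begin

definition eqv :: "'a \<Rightarrow> 'a \<Rightarrow> bool" (infix "\<doteq>" 50) where
  "a \<doteq> b \<longleftrightarrow> a - b \<in> M"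

lemma uminus_mem: "a \<in> M \<Longrightarrow> - a \<in> M"
  using mult_mem[of a "-1"] by simp

lemma eqv_refl [simp, intro!]: "a \<doteq> a"
  by (simp add: eqv_def zero_mem)

lemma eqv_sym: "a \<doteq> b \<Longrightarrow> b \<doteq> a"
  using uminus_mem[of "a - b"] by (simp add: eqv_def)

lemma eqv_trans [trans]: "a \<doteq> b \<Longrightarrow> b \<doteq> c \<Longrightarrow> a \<doteq> c"
  using add_mem[of "a - b" "b - c"] by (simp add: eqv_def)

lemma eqv_add: "a \<doteq> b \<Longrightarrow> c \<doteq> d \<Longrightarrow> a + c \<doteq> b + d"
  using add_mem[of "a - b" "c - d"] by (simp add: eqv_def algebra_simps)

lemma eqv_uminus: "a \<doteq> b \<Longrightarrow> - a \<doteq> - b"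
  using uminus_mem[of "a - b"] by (simp add: eqv_def)

lemma eqv_diff: "a \<doteq> b \<Longrightarrow> c \<doteq> d \<Longrightarrow> a - c \<doteq> b - d"
  using eqv_add[of a b "- c" "- d"] eqv_uminus by simp

lemma eqv_mult: "a \<doteq> b \<Longrightarrow> c \<doteq> d \<Longrightarrow> a * c \<doteq> b * d"
  using add_mem[OF mult_mem[of "a - b" c] mult_mem[of "c - d" b]]
  by (simp add: eqv_def algebra_simps)

lemma eqv_power: "a \<doteq> b \<Longrightarrow> a ^ n \<doteq> b ^ n"
  by (induction n) (auto intro: eqv_mult)

lemma eqv_sum: "(\<And>i. i \<in> A \<Longrightarrow> f i \<doteq> g i) \<Longrightarrow> sum f A \<doteq> sum g A"
  by (induction A rule: infinite_finite_induct) (auto intro: eqv_add)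

lemma eqv_iff_diff: "a \<doteq> b \<longleftrightarrow> a - b \<doteq> 0"
  by (simp add: eqv_def)

lemma eqv_mult_0D: "a * b \<doteq> 0 \<Longrightarrow> a \<doteq> 0 \<or> b \<doteq> 0"
  using prime by (simp add: eqv_def)

lemma not_one_eqv_0: "\<not> 1 \<doteq> 0"
  using one_notin by (simp add: eqv_def)

lemma eqv_mult_left_cancel: "c * a \<doteq> c * b \<Longrightarrow> \<not> c \<doteq> 0 \<Longrightarrow> a \<doteq> b"
  using eqv_mult_0D[of c "a - b"] by (simp add: eqv_def right_diff_distrib)

lemma eqv_power_0D: "a ^ n \<doteq> 0 \<Longrightarrow> a \<doteq> 0"
  by (induction n) (use not_one_eqv_0 eqv_mult_0D in auto)

text \<open>\<open>p\<close> divides every inner binomial coefficient and vanishes modulo the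
  ideal.\<close>

lemma freshmans_dream_eqv:
  assumes p: "Factorial_Ring.prime p" and "of_nat p \<doteq> 0"
  shows "(a + b) ^ p \<doteq> a ^ p + b ^ p"
proof -
  have p0: "p > 0" using p by (simp add: prime_gt_0_nat)
  have "(a + b) ^ p = (\<Sum>k\<le>p. of_nat (p choose k) * a ^ k * b ^ (p - k))"
    by (rule binomial_ring)
  also have "\<dots> \<doteq> (\<Sum>k\<le>p. if k \<in> {0, p} then a ^ k * b ^ (p - k) else 0)"
  proof (rule eqv_sum)
    fix k assume "k \<in> {..p}"
    show "of_nat (p choose k) * a ^ k * b ^ (p - k)
        \<doteq> (if k \<in> {0, p} then a ^ k * b ^ (p - k) else 0)"
    proof (cases "k \<in> {0, p}")
      case False
      then have "p dvd (p choose k)"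
        using \<open>k \<in> {..p}\<close> p by (intro dvd_choose_prime) auto
      then obtain m where "p choose k = p * m" by (auto simp: dvd_def)
      then show ?thesis
        using False eqv_mult[OF assms(2), of "of_nat m * a ^ k * b ^ (p - k)"] by (auto simp: mult_ac)
    qed auto
  qed
  also have "(\<Sum>k\<le>p. if k \<in> {0, p} then a ^ k * b ^ (p - k) else 0)
      = (\<Sum>k\<in>{0, p}. a ^ k * b ^ (p - k))"
    by (subst sum.inter_restrict[symmetric]) (auto intro!: sum.cong)
  also have "\<dots> = a ^ p + b ^ p" using p0 by simp
  finally show ?thesis .
qed

lemma freshmans_dream_eqv':
  assumes p: "Factorial_Ring.prime p" "of_nat p \<doteq> 0"
  shows "(a + b) ^ (p ^ k) \<doteq> a ^ (p ^ k) + b ^ (p ^ k)"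
proof (induction k)
  case (Suc k)
  have "(a + b) ^ (p ^ Suc k) = ((a + b) ^ (p ^ k)) ^ p"
    by (metis power_Suc2 power_mult)
  also have "\<dots> \<doteq> (a ^ (p ^ k) + b ^ (p ^ k)) ^ p" by (intro eqv_power Suc)
  also have "\<dots> \<doteq> (a ^ (p ^ k)) ^ p + (b ^ (p ^ k)) ^ p" by (rule freshmans_dream_eqv[OF p])
  also have "\<dots> = a ^ (p ^ Suc k) + b ^ (p ^ Suc k)" by (metis power_Suc2 power_mult)
  finally show ?case .
qed auto

end

section \<open>Construction of finite residue fields\<close>

text \<open>Zorn's lemma provides an ideal maximal among the proper ideals above \<open>I\<close>,
  and a maximal ideal is prime.\<close>

lemma exists_prime_ideal:
  fixes I :: "'a::comm_ring_1 set"
  assumes "0 \<in> I" "\<And>a b. a \<in> I \<Longrightarrow> b \<in> I \<Longrightarrow> a + b \<in> I" "\<And>a r. a \<in> I \<Longrightarrow> r * a \<in> I" "1 \<notin> I"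
  obtains M where "I \<subseteq> M" "prime_ideal M"
proof -
  define ideal where "ideal J \<longleftrightarrow> I \<subseteq> J \<and> (\<forall>a\<in>J. \<forall>b\<in>J. a + b \<in> J) \<and> (\<forall>a\<in>J. \<forall>r. r * a \<in> J) \<and> 1 \<notin> J"
    for J :: "'a set"
  have "\<exists>M\<in>Collect ideal. \<forall>J\<in>Collect ideal. M \<subseteq> J \<longrightarrow> J = M"
  proof (rule subset_Zorn_nonempty)
    have "ideal I" unfolding ideal_def using assms by blast
    then show "Collect ideal \<noteq> {}" by blast
    fix \<C> assume \<C>: "\<C> \<noteq> {}" "subset.chain (Collect ideal) \<C>"
    have ch: "ideal J" if "J \<in> \<C>" for J using \<C> that by (auto simp: subset_chain_def)
    have "a + b \<in> \<Union> \<C>" if ab: "a \<in> \<Union> \<C>" "b \<in> \<Union> \<C>" for a b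
    proof -
      obtain J J' where J: "J \<in> \<C>" "a \<in> J" "J' \<in> \<C>" "b \<in> J'" using ab by blast
      then have "J \<subseteq> J' \<or> J' \<subseteq> J" using \<C> by (auto simp: subset_chain_def)
      then show ?thesis using J ch unfolding ideal_def by blast
    qed
    moreover have "r * a \<in> \<Union> \<C>" if "a \<in> \<Union> \<C>" for a r
      using that ch unfolding ideal_def by blast
    moreover have "I \<subseteq> \<Union> \<C>" "1 \<notin> \<Union> \<C>" using ch \<C>(1) unfolding ideal_def by blast+
    ultimately show "\<Union> \<C> \<in> Collect ideal" by (simp add: ideal_def)
  qed
  then obtain M where M: "ideal M" and max: "\<And>J. ideal J \<Longrightarrow> M \<subseteq> J \<Longrightarrow> J = M" by blast
  have M0: "0 \<in> M" using M assms(1) by (auto simp: ideal_def)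
  have "a \<in> M \<or> b \<in> M" if ab: "a * b \<in> M" for a b
  proof (rule ccontr)
    assume neg: "\<not> (a \<in> M \<or> b \<in> M)"
    \<comment> \<open>The ideal generated by \<open>M\<close> and \<open>a\<close>; by maximality of
      \<open>M\<close> it contains 1.\<close>
    define J where "J = {m + r * a | m r. m \<in> M}"
    have J: "m + r * a \<in> J" if "m \<in> M" for m r using that by (auto simp: J_def)
    have aJ: "a \<in> J" using J[OF M0, of 1] by simp
    have MJ: "M \<subseteq> J" using J[of _ 0] by auto
    have "x + y \<in> J" if xy: "x \<in> J" "y \<in> J" for x y
    proof -
      obtain m r m' r' where "x = m + r * a" "y = m' + r' * a" "m \<in> M" "m' \<in> M"
        using xy by (auto simp: J_def)
      then have "x + y = (m + m') + (r + r') * a" "m + m' \<in> M"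
        using M by (auto simp: ideal_def algebra_simps)
      then show ?thesis unfolding J_def by blast
    qed
    moreover have "s * x \<in> J" if x: "x \<in> J" for x s
    proof -
      obtain m r where "x = m + r * a" "m \<in> M"
        using x by (auto simp: J_def)
      then have "s * x = s * m + (s * r) * a" "s * m \<in> M"
        using M by (auto simp: ideal_def algebra_simps)
      then show ?thesis unfolding J_def by blast
    qed
    moreover have "I \<subseteq> J" using M MJ by (auto simp: ideal_def)
    ultimately have "1 \<in> J" using max[of J] MJ aJ neg unfolding ideal_def by blast
    then obtain m r where m: "1 = m + r * a" "m \<in> M" by (auto simp: J_def)
    then have "b = (m + r * a) * b" by simp
    also have "\<dots> = b * m + r * (a * b)" by (simp add: algebra_simps)
    also have "\<dots> \<in> M" using m ab M by (auto simp: ideal_def)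
    finally show False using neg by simp
  qed
  then have "prime_ideal M" using M M0 by unfold_locales (auto simp: ideal_def)
  then show thesis using that M by (auto simp: ideal_def)
qed

text \<open>The field with \<open>Q\<close> elements as residues modulo \<open>M\<close>, with the primitive element \<open>z\<close>; there is no
  type of field elements because \<open>Q\<close> is a variable.\<close>

locale galois_residues = prime_ideal M for M :: "'a::comm_ring_1 set" +
  fixes z :: 'a and Q p k :: nat
  assumes Q: "Q = p ^ k" and prime_p: "Factorial_Ring.prime p" and k: "k > 0"
    and of_nat_p: "of_nat p \<doteq> 0"
    and power_root: "z ^ (Q - 1) \<doteq> 1"
    and inj_power: "\<lbrakk>i < Q - 1; j < Q - 1; z ^ i \<doteq> z ^ j\<rbrakk> \<Longrightarrow> i = j"
    and exhaust_power: "a \<doteq> 0 \<or> (\<exists>i<Q - 1. a \<doteq> z ^ i)"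

text \<open>\<open>g(\<zeta>)\<close> is an eigenvalue of the integer circulant matrix of \<open>g\<close>, hence an algebraic integer.\<close>

lemma root_of_unity_poly_neq_inverse:
  fixes \<zeta> :: complex and g :: "int poly"
  assumes \<zeta>: "\<zeta> ^ N = 1" "N > 0" and p: "p > 1"
  shows "of_nat p * poly (of_int_poly g) \<zeta> \<noteq> 1"
proof
  assume eq: "of_nat p * poly (of_int_poly g) \<zeta> = 1"
  define x where "x = poly (of_int_poly g) \<zeta>"
  \<comment> \<open>Row \<open>j\<close> writes \<open>g(\<zeta>) \<zeta>^j\<close> in the powers of
    \<zeta> below \<open>N\<close>, with exponents reduced by \<open>\<zeta>^N = 1\<close>.\<close>
  define A :: "int mat" where
    "A = mat N N (\<lambda>(j, k). \<Sum>i\<le>degree g. if (i + j) mod N = k then coeff g i else 0)"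
  let ?A = "map_mat of_int A :: complex mat"
  define v where "v = vec N (\<lambda>j. \<zeta> ^ j)"
  have A: "A \<in> carrier_mat N N" by (simp add: A_def)
  have x: "x = (\<Sum>i\<le>degree g. of_int (coeff g i) * \<zeta> ^ i)"
    unfolding x_def by (simp add: poly_altdef)
  have mod: "\<zeta> ^ (k mod N) = \<zeta> ^ k" for k
  proof -
    have "\<zeta> ^ k = \<zeta> ^ (N * (k div N) + k mod N)" by simp
    also have "\<dots> = \<zeta> ^ (k mod N)" using \<zeta> by (simp only: power_add power_mult power_one mult_1_left)
    finally show ?thesis by simp
  qed
  have "?A *\<^sub>v v = x \<cdot>\<^sub>v v"
  proof (rule eq_vecI)
    fix j assume "j < dim_vec (x \<cdot>\<^sub>v v)"
    then have j: "j < N" by (simp add: v_def)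
    have "(?A *\<^sub>v v) $ j
        = (\<Sum>k<N. \<Sum>i\<le>degree g. if (i + j) mod N = k then of_int (coeff g i) * \<zeta> ^ k else 0)"
      using j by (auto simp: A_def v_def scalar_prod_def sum_distrib_right lessThan_atLeast0 intro!: sum.cong)
    also have "\<dots> = (\<Sum>i\<le>degree g. \<Sum>k<N. if (i + j) mod N = k then of_int (coeff g i) * \<zeta> ^ k else 0)"
      by (rule sum.swap)
    also have "\<dots> = (\<Sum>i\<le>degree g. of_int (coeff g i) * \<zeta> ^ (i + j))"
      using \<zeta> by (intro sum.cong refl) (simp add: mod)
    also have "\<dots> = x * \<zeta> ^ j" by (simp add: x sum_distrib_left sum_distrib_right power_add mult_ac)
    finally show "(?A *\<^sub>v v) $ j = (x \<cdot>\<^sub>v v) $ j" using j by (simp add: v_def)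
  qed (auto simp: A_def v_def)
  moreover have "v \<noteq> 0\<^sub>v N"
  proof
    assume "v = 0\<^sub>v N"
    then have "v $ 0 = 0" using \<zeta> by simp
    then show False using \<zeta> by (simp add: v_def)
  qed
  ultimately have "eigenvalue ?A x"
    unfolding eigenvalue_def eigenvector_def using A by (intro exI[of _ v]) (auto simp: v_def)
  then have "poly (char_poly ?A) x = 0"
    using eigenvalue_root_char_poly[of ?A N] A by auto
  then have "poly (of_int_poly (char_poly A)) x = 0"
    by (simp add: of_int_hom.char_poly_hom[OF A])
  then have "algebraic_int x"
    using degree_monic_char_poly[OF A] by (auto simp: algebraic_int_altdef_ipoly)
  \<comment> \<open>A rational algebraic integer is an integer, but no integer is the inverse of
    \<open>p > 1\<close>.\<close>
  moreover have xp: "x = 1 / of_nat p"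
    using eq p by (simp add: x_def field_simps)
  moreover have "1 / of_nat p \<in> (\<rat> :: complex set)" by simp
  ultimately have "x \<in> \<int>" using rational_algebraic_int_is_int by blast
  then obtain m where "x = of_int m" by (auto elim: Ints_cases)
  then have "of_int (int p * m) = (1 :: complex)" using eq by (simp add: x_def)
  then have "int p * m = 1" by (simp only: of_int_eq_1_iff)
  then show False using p by (simp add: zmult_eq_1_iff)
qed

text \<open>The powers of \<open>z\<close> stay distinct modulo \<open>M\<close> because the
  geometric sums of \<open>\<zeta>^d\<close> vanish while \<open>N\<close> is congruent to -1. They
  exhaust the nonzero residues because each of these is a root of \<open>Y^N - 1\<close>, whose only
  roots are the \<open>N\<close> powers.\<close>

lemma exists_galois_residues:
  assumes p: "Factorial_Ring.prime p" and k: "k > 0"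
  obtains M :: "int poly set" and z where "galois_residues M z (p ^ k) p k"
proof -
  define N where "N = p ^ k - 1"
  have "p \<le> p ^ k" using k p prime_gt_0_nat[OF p] by (simp add: self_le_power)
  then have pk: "p ^ k = Suc N" and N: "N > 0"
    using prime_gt_1_nat[OF p] unfolding N_def by linarith+
  define \<zeta> where "\<zeta> = cis (2 * pi / N)"
  have \<zeta>N: "\<zeta> ^ N = 1" using N by (simp add: \<zeta>_def DeMoivre)
  have \<zeta>d: "\<zeta> ^ d \<noteq> 1" if "0 < d" "d < N" for d
  proof
    assume "\<zeta> ^ d = 1"
    then have "cis (2 * pi * (d / N)) = 1" by (simp add: \<zeta>_def DeMoivre mult_ac)
    then have "cos (2 * pi * (d / N)) = 1" by (simp add: complex_eq_iff)
    then obtain m :: int where "2 * pi * (d / N) = real_of_int m * 2 * pi" using cos_one_2pi_int by blast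
    then have "pi * real d = pi * (m * real N)" using N by (simp add: field_simps)
    then have "real d = m * real N" by (simp only: mult_cancel_left pi_neq_zero simp_thms)
    then have "int d = m * int N" by (metis of_int_eq_iff of_int_mult of_int_of_nat_eq)
    then have "N dvd d" by (metis dvd_triv_right int_dvd_int_iff)
    then show False using that by (auto dest: dvd_imp_le)
  qed
  have geo: "(\<Sum>i<N. (\<zeta> ^ d) ^ i) = 0" if "0 < d" "d < N" for d
  proof -
    have "(\<zeta> ^ d) ^ N = 1" using \<zeta>N by (metis mult.commute power_mult power_one)
    then show ?thesis using \<zeta>d[OF that] by (simp add: sum_gp_strict)
  qed
  define ev :: "int poly \<Rightarrow> complex" where "ev f = poly (of_int_poly f) \<zeta>" for f
  have ev_hom: "ev (f + g) = ev f + ev g" "ev (f * g) = ev f * ev g" "ev (f - g) = ev f - ev g"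
      "ev (of_nat m) = of_nat m" "ev 0 = 0" "ev 1 = 1" for f g m
    by (simp_all add: ev_def hom_distribs)
  have ev_pow: "ev (f ^ m) = ev f ^ m" for f m by (induction m) (auto simp: ev_hom)
  have ev_sum: "ev (sum h A) = (\<Sum>i\<in>A. ev (h i))" for h :: "nat \<Rightarrow> _" and A
    by (induction A rule: infinite_finite_induct) (auto simp: ev_hom)
  define z where "z = [:0, 1 :: int:]"
  have ev_z: "ev z = \<zeta>" by (simp add: ev_def z_def)
  \<comment> \<open>The preimage of \<open>p Z[\<zeta>]\<close> under evaluation; it contains the
    kernel of evaluation and is proper by \<open>root_of_unity_poly_neq_inverse\<close>.\<close>
  define I where "I = {f. \<exists>g. ev f = of_nat p * ev g}"
  obtain M where I: "I \<subseteq> M" and M: "prime_ideal M"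
  proof (rule exists_prime_ideal)
    show "0 \<in> I" by (auto simp: I_def ev_hom intro: exI[of _ 0])
    show "a + b \<in> I" if "a \<in> I" "b \<in> I" for a b
      using that by (auto simp: I_def ev_hom simp flip: distrib_left) (metis ev_hom(1))
    show "r * a \<in> I" if "a \<in> I" for r a
      using that by (auto simp: I_def ev_hom mult.left_commute) (metis ev_hom(2))
    show "1 \<notin> I"
      using root_of_unity_poly_neq_inverse[OF \<zeta>N N prime_gt_1_nat[OF p]]
      by (auto simp: I_def ev_hom) (metis ev_def)
  qed
  interpret prime_ideal M by (rule M)
  write eqv (infix "\<doteq>" 50)
  \<comment> \<open>Transfer from the complex numbers: equal values at \<zeta> give congruent
    polynomials.\<close>
  have ker: "f \<doteq> g" if "ev f = ev g" for f g
    using I that unfolding eqv_def I_def by (force simp: ev_hom intro: exI[of _ 0])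
  have p0: "of_nat p \<doteq> 0"
    using I unfolding eqv_def I_def by (force simp: ev_hom intro: exI[of _ 1])
  have pk0: "of_nat (p ^ k) \<doteq> 0"
    using eqv_power[OF p0, of k] k by (simp add: zero_power)
  have N1: "of_nat N \<doteq> -1"
    using pk0 unfolding pk eqv_def by (simp add: add.commute)
  have Nn0: "\<not> of_nat N \<doteq> 0"
  proof
    assume "of_nat N \<doteq> 0"
    then have "- 1 \<doteq> 0" using N1 eqv_sym eqv_trans by blast
    then have "- (- 1) \<doteq> - 0" by (rule eqv_uminus)
    then show False using not_one_eqv_0 by simp
  qed
  have power_commutes_exp: "(x ^ i) ^ j = (x ^ j) ^ i" for x :: complex and i j
    by (metis mult.commute power_mult)
  have zN: "z ^ N \<doteq> 1" by (rule ker) (simp add: ev_pow ev_z \<zeta>N ev_hom)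
  have z0: "\<not> z ^ i \<doteq> 0" for i
  proof
    assume "z ^ i \<doteq> 0"
    then have "z ^ N \<doteq> 0" using eqv_power[OF eqv_power_0D, of z i N] N by (simp add: zero_power)
    then show False using eqv_trans[OF eqv_sym[OF zN]] not_one_eqv_0 by simp
  qed
  \<comment> \<open>If \<open>z ^ d\<close> were 1, the geometric sum of its powers would be
    \<open>N\<close>, whereas its value at \<zeta> is 0.\<close>
  have zd: False if d: "0 < d" "d < N" and zd: "z ^ d \<doteq> 1" for d
  proof -
    have "of_nat N = (\<Sum>i<N. 1 :: int poly)" by simp
    also have "\<dots> \<doteq> (\<Sum>i<N. (z ^ d) ^ i)"
      using eqv_power[OF zd] by (intro eqv_sum) (auto intro: eqv_sym)
    also have "\<dots> \<doteq> 0"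
      by (rule ker) (simp add: ev_sum ev_pow ev_z geo[OF d] ev_hom)
    finally show False using Nn0 by simp
  qed
  have inj: "i = j" if "i < N" "j < N" "z ^ i \<doteq> z ^ j" for i j
    using that
  proof (induction i j rule: linorder_wlog)
    case (le i j)
    have "z ^ i * z ^ (j - i) \<doteq> z ^ i * 1"
      using le eqv_sym by (simp flip: power_add)
    then have "z ^ (j - i) \<doteq> 1" using z0 eqv_mult_left_cancel by blast
    then show ?case using zd[of "j - i"] le by fastforce
  qed (auto intro: eqv_sym)
  have frob: "(a + b) ^ (p ^ k) \<doteq> a ^ (p ^ k) + b ^ (p ^ k)" for a b
    by (rule freshmans_dream_eqv'[OF p p0])
  have nat_pow: "of_nat m ^ (p ^ k) \<doteq> of_nat m" for m
  proof (induction m)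
    case (Suc m)
    have "(of_nat m + 1) ^ (p ^ k) \<doteq> of_nat m ^ (p ^ k) + 1 ^ (p ^ k)" by (rule frob)
    also have "\<dots> \<doteq> of_nat m + 1" using Suc by (intro eqv_add) auto
    finally show ?case by (simp add: add.commute)
  qed (simp add: pk)
  have int_pow: "of_int m ^ (p ^ k) \<doteq> of_int m" for m
  proof -
    have "of_int m \<doteq> of_nat (nat (m mod int (p ^ k)))"
    proof -
      have "of_int m = of_nat (p ^ k) * of_int (m div int (p ^ k)) + (of_int (m mod int (p ^ k)) :: int poly)"
        by (metis mult_div_mod_eq of_int_add of_int_mult of_int_of_nat_eq)
      moreover have "of_int (m mod int (p ^ k)) = (of_nat (nat (m mod int (p ^ k))) :: int poly)"
        using pk by (simp add: of_nat_nat)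
      ultimately show ?thesis
        using eqv_add[OF eqv_mult[OF pk0 eqv_refl] eqv_refl] by (metis add_0 mult_zero_left)
    qed
    then show ?thesis using nat_pow eqv_power eqv_sym eqv_trans by meson
  qed
  \<comment> \<open>Raising to the power \<open>p ^ k\<close> is additive and multiplicative modulo
    \<open>M\<close> and fixes both the integers and \<open>z\<close>, hence every polynomial in
    \<open>z\<close>.\<close>
  have pow: "f ^ (p ^ k) \<doteq> f" for f
  proof (induction f)
    case (pCons a f)
    have eq: "pCons a f = of_int a + z * f" by (simp add: z_def of_int_poly)
    have "(of_int a + z * f) ^ (p ^ k) \<doteq> of_int a ^ (p ^ k) + z ^ (p ^ k) * f ^ (p ^ k)"
      using frob[of "of_int a" "z * f"] by (simp add: power_mult_distrib)
    also have "\<dots> \<doteq> of_int a + z * f"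
      using eqv_mult[OF eqv_refl[of z] zN] pCons
      by (intro eqv_add eqv_mult int_pow) (auto simp: pk)
    finally show ?case unfolding eq .
  qed (simp add: pk)
  have exh: "f \<doteq> 0 \<or> (\<exists>i<N. f \<doteq> z ^ i)" for f
  proof (rule ccontr)
    assume neg: "\<not> (f \<doteq> 0 \<or> (\<exists>i<N. f \<doteq> z ^ i))"
    then have fN: "f ^ N \<doteq> 1"
      using pow[of f] eqv_mult_left_cancel[of f "f ^ N" 1] by (auto simp: pk)
    \<comment> \<open>\<open>f ^ N\<close> and \<open>(z ^ j) ^ N\<close> are both 1, so the
      cofactor of \<open>f - z ^ j\<close> in their difference vanishes.\<close>
    have "(\<Sum>l<N. (z ^ j) ^ (N - Suc l) * f ^ l) \<doteq> 0" if j: "j < N" for j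
    proof -
      have "(f - z ^ j) * (\<Sum>l<N. (z ^ j) ^ (N - Suc l) * f ^ l) = f ^ N - (z ^ j) ^ N"
        by (simp add: power_diff_sumr2)
      also have "\<dots> \<doteq> 1 - 1 ^ j"
      proof (rule eqv_diff[OF fN])
        have "(z ^ j) ^ N = (z ^ N) ^ j" by (metis mult.commute power_mult)
        then show "(z ^ j) ^ N \<doteq> 1 ^ j" using eqv_power[OF zN, of j] by simp
      qed
      finally have "(f - z ^ j) * (\<Sum>l<N. (z ^ j) ^ (N - Suc l) * f ^ l) \<doteq> 0" by simp
      moreover have "\<not> f - z ^ j \<doteq> 0" using neg j eqv_iff_diff by blast
      ultimately show ?thesis using eqv_mult_0D by blast
    qed
    then have "0 \<doteq> (\<Sum>j<N. \<Sum>l<N. (z ^ j) ^ (N - Suc l) * f ^ l)"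
      using eqv_sum[of "{..<N}" "\<lambda>_. 0"] eqv_sym by simp
    also have "\<dots> = (\<Sum>l<N. \<Sum>j<N. (z ^ j) ^ (N - Suc l) * f ^ l)" by (rule sum.swap)
    \<comment> \<open>Summing over \<open>j\<close> leaves only \<open>l = N - 1\<close>, where the
      exponent of \<open>z ^ j\<close> is 0; the other sums vanish at \<zeta>.\<close>
    also have "\<dots> \<doteq> (\<Sum>l<N. if l = N - 1 then of_nat N * f ^ l else 0)"
    proof (rule eqv_sum, rule ker)
      fix l assume l: "l \<in> {..<N}"
      have "(\<Sum>j<N. (\<zeta> ^ j) ^ (N - Suc l)) = (if l = N - 1 then of_nat N else 0)"
      proof (cases "l = N - 1")
        case False
        then have "(\<Sum>j<N. (\<zeta> ^ (N - Suc l)) ^ j) = 0" using l by (intro geo) auto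
        then show ?thesis using False by (simp add: power_commutes_exp[of _ "N - Suc l"])
      qed (use N in auto)
      then show "ev (\<Sum>j<N. (z ^ j) ^ (N - Suc l) * f ^ l)
          = ev (if l = N - 1 then of_nat N * f ^ l else 0)"
        by (auto simp: ev_sum ev_hom ev_pow ev_z simp flip: sum_distrib_right)
    qed
    also have "\<dots> = of_nat N * f ^ (N - 1)" using N by simp
    finally have "of_nat N * f ^ (N - 1) \<doteq> 0" by (rule eqv_sym)
    then show False using Nn0 neg eqv_mult_0D eqv_power_0D by blast
  qed
  have "galois_residues M z (p ^ k) p k"
    using p k p0 zN inj exh by unfold_locales (auto simp: N_def)
  then show thesis by (rule that)
qed

section \<open>Power sums and interpolation in the residue field\<close>

context prime_ideal
begin

lemma eqv_uminus_iff: "- a \<doteq> - b \<longleftrightarrow> a \<doteq> b"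
  using eqv_uminus by fastforce

lemma eqv_add_left_cancel: "a + b \<doteq> a + c \<longleftrightarrow> b \<doteq> c"
  by (simp add: eqv_def)

lemma eqv_prod_0D: "finite A \<Longrightarrow> (\<Prod>i\<in>A. f i) \<doteq> 0 \<Longrightarrow> \<exists>i\<in>A. f i \<doteq> 0"
  by (induction A rule: finite_induct) (use not_one_eqv_0 eqv_mult_0D in auto)

end

context galois_residues
begin

lemma Q_gt_1: "Q > 1"
  unfolding Q using prime_gt_1_nat[OF prime_p] k by (intro one_less_power)

lemma of_nat_Q_pred: "of_nat (Q - 1) \<doteq> -1"
proof -
  have "of_nat Q \<doteq> 0" using eqv_power[OF of_nat_p, of k] k by (simp add: Q zero_power)
  moreover have "Q = Suc (Q - 1)" using Q_gt_1 by simp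
  then have "(of_nat Q :: 'a) = of_nat (Q - 1) + 1" by (metis of_nat_Suc add.commute)
  ultimately show ?thesis by (simp add: eqv_def)
qed

lemma power_mult_root: "z ^ ((Q - 1) * m) \<doteq> 1"
  using eqv_power[OF power_root, of m] by (simp add: power_mult)

lemma power_add_mult_root: "z ^ (i + (Q - 1) * m) \<doteq> z ^ i"
  using eqv_mult[OF eqv_refl[of "z ^ i"] power_mult_root[of m]] by (simp add: power_add)

lemma power_eqv_mod: "z ^ i \<doteq> z ^ (i mod (Q - 1))"
  using power_add_mult_root[of "i mod (Q - 1)" "i div (Q - 1)"] by (simp add: add.commute)

lemma power_eqv_one_iff: "z ^ i \<doteq> 1 \<longleftrightarrow> Q - 1 dvd i"
proof
  assume "z ^ i \<doteq> 1"
  then have "z ^ (i mod (Q - 1)) \<doteq> z ^ 0"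
    using eqv_trans[OF eqv_sym[OF power_eqv_mod[of i]]] by simp
  then have "i mod (Q - 1) = 0" using Q_gt_1 by (intro inj_power) auto
  then show "Q - 1 dvd i" by auto
next
  assume "Q - 1 dvd i"
  then show "z ^ i \<doteq> 1" using power_mult_root by blast
qed

lemma not_power_eqv_0: "\<not> z ^ i \<doteq> 0"
proof
  assume "z ^ i \<doteq> 0"
  then have "z ^ i * z ^ ((Q - 1) * i - i) \<doteq> 0"
    using eqv_mult[of "z ^ i" 0] by fastforce
  moreover have "i \<le> (Q - 1) * i" using Q_gt_1 by (cases "Q - 1") auto
  ultimately have "z ^ ((Q - 1) * i) \<doteq> 0" by (simp flip: power_add)
  then show False using power_mult_root[of i] not_one_eqv_0 eqv_sym eqv_trans by blast
qed

lemma inverse_eqv: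
  assumes "\<not> a \<doteq> 0"
  obtains b where "b * a \<doteq> 1"
proof -
  obtain i where i: "i < Q - 1" "a \<doteq> z ^ i" using assms exhaust_power by blast
  then have "z ^ (Q - 1 - i) * a \<doteq> z ^ (Q - 1 - i) * z ^ i" by (intro eqv_mult) auto
  also have "\<dots> = z ^ (Q - 1)" using i by (simp flip: power_add)
  also have "\<dots> \<doteq> 1" by (rule power_root)
  finally show thesis by (rule that)
qed

text \<open>A geometric series, unless \<open>z ^ m\<close> is 1 and the sum counts its
  \<open>Q - 1\<close> terms. These sums later extract the coefficients of polynomials from their
  values.\<close>

lemma sum_powers: "(\<Sum>i<Q - 1. (z ^ m) ^ i) \<doteq> (if Q - 1 dvd m then -1 else 0)"
proof (cases "Q - 1 dvd m")
  case True
  then have "z ^ m \<doteq> 1" by (simp add: power_eqv_one_iff)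
  then have "(\<Sum>i<Q - 1. (z ^ m) ^ i) \<doteq> (\<Sum>i<Q - 1. 1)"
    using eqv_power by (intro eqv_sum) fastforce
  also have "\<dots> = of_nat (Q - 1)" by simp
  also have "\<dots> \<doteq> -1" by (rule of_nat_Q_pred)
  finally show ?thesis using True by simp
next
  case False
  have "(z ^ m - 1) * (\<Sum>i<Q - 1. (z ^ m) ^ i) = z ^ ((Q - 1) * m) - 1"
    unfolding power_diff_1_eq[symmetric] by (metis mult.commute power_mult)
  also have "\<dots> \<doteq> 0" using power_mult_root by (simp add: eqv_iff_diff[symmetric])
  finally have "(z ^ m - 1) * (\<Sum>i<Q - 1. (z ^ m) ^ i) \<doteq> 0" .
  moreover have "\<not> z ^ m - 1 \<doteq> 0"
    using False by (simp add: eqv_iff_diff[symmetric] power_eqv_one_iff)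
  ultimately have "(\<Sum>i<Q - 1. (z ^ m) ^ i) \<doteq> 0" using eqv_mult_0D by blast
  then show ?thesis using False by simp
qed

text \<open>A system of representatives, since counting messages requires elements rather than
  congruence classes.\<close>

definition residues :: "'a set" where
  "residues = insert 0 ((\<lambda>i. z ^ i) ` {..<Q - 1})"

lemma residues_exhaust: "\<exists>t\<in>residues. a \<doteq> t"
  using exhaust_power[of a] by (auto simp: residues_def)

lemma residues_inj: "\<lbrakk>s \<in> residues; t \<in> residues; s \<doteq> t\<rbrakk> \<Longrightarrow> s = t"
  using inj_power not_power_eqv_0 eqv_sym[of 0] by (auto simp: residues_def)

lemma card_residues: "card residues = Q"
proof -
  have "inj_on (\<lambda>i. z ^ i) {..<Q - 1}" by (intro inj_onI inj_power) auto
  moreover have "0 \<notin> (\<lambda>i. z ^ i) ` {..<Q - 1}"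
    using not_power_eqv_0 by (metis eqv_refl imageE)
  ultimately show ?thesis using Q_gt_1 by (simp add: residues_def card_image)
qed

text \<open>Newton interpolation, one node at a time. The degree bound is put on the coefficients so
  that it makes sense for empty \<open>S\<close>.\<close>

lemma interpolation:
  assumes "finite S" "S \<subseteq> {..<Q - 1}"
  shows "\<exists>f :: 'a poly. (\<forall>l\<ge>card S. coeff f l = 0) \<and> (\<forall>i\<in>S. poly f (z ^ i) \<doteq> v i)"
  using assms
proof (induction S rule: finite_induct)
  case empty
  then show ?case by (intro exI[of _ 0]) auto
next
  case (insert a S)
  then obtain f :: "'a poly" where f: "\<forall>l\<ge>card S. coeff f l = 0" "\<forall>i\<in>S. poly f (z ^ i) \<doteq> v i"
    by auto
  \<comment> \<open>Vanishes at the old nodes but not at the new one, so a multiple of it corrects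
    the value there.\<close>
  define g where "g = (\<Prod>s\<in>S. [:- (z ^ s), 1:])"
  have "degree g \<le> (\<Sum>s\<in>S. degree [:- (z ^ s), 1:])" 
    unfolding g_def using degree_prod_sum_le[OF insert(1), of "\<lambda>s. [:- (z ^ s), 1:]"] by (simp add: o_def)
  then have deg: "degree g \<le> card S" by simp
  have g0: "poly g (z ^ i) = 0" if "i \<in> S" for i
    using that insert(1) by (auto simp: g_def poly_prod intro!: prod_zero bexI[of _ i])
  have "\<not> poly g (z ^ a) \<doteq> 0"
  proof
    assume "poly g (z ^ a) \<doteq> 0"
    then have "(\<Prod>s\<in>S. z ^ a - z ^ s) \<doteq> 0" by (simp add: g_def poly_prod)
    then obtain s where s: "s \<in> S" "z ^ a - z ^ s \<doteq> 0" using eqv_prod_0D[OF insert(1)] by blast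
    then have "a = s" using insert.prems by (intro inj_power) (auto simp: eqv_iff_diff[symmetric])
    then show False using s insert by simp
  qed
  then obtain b where b: "b * poly g (z ^ a) \<doteq> 1" by (rule inverse_eqv)
  define h where "h = f + Polynomial.smult ((v a - poly f (z ^ a)) * b) g"
  have "poly h (z ^ a) = poly f (z ^ a) + (v a - poly f (z ^ a)) * (b * poly g (z ^ a))"
    by (simp add: h_def mult_ac)
  also have "\<dots> \<doteq> poly f (z ^ a) + (v a - poly f (z ^ a)) * 1"
    using b by (intro eqv_add eqv_mult) auto
  finally have "poly h (z ^ a) \<doteq> v a" by simp
  moreover have "poly h (z ^ i) \<doteq> v i" if "i \<in> S" for i
    using that f g0 by (simp add: h_def)
  moreover have "coeff h l = 0" if "l \<ge> card (insert a S)" for l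
    using that f deg insert by (simp add: h_def coeff_eq_0)
  ultimately show ?case by (intro exI[of _ h]) auto
qed

text \<open>Casts interpolation into sums with a fixed number of coefficients, the shape in which
  trace words are written.\<close>

lemma interpolation_sum:
  assumes "S \<subseteq> {..<Q - 1}" "card S \<le> m"
  obtains f where "\<And>i. i \<in> S \<Longrightarrow> (\<Sum>l<m. f l * z ^ (i * l)) \<doteq> v i"
proof -
  obtain f :: "'a poly" where f: "\<forall>l\<ge>card S. coeff f l = 0" "\<forall>i\<in>S. poly f (z ^ i) \<doteq> v i"
    using interpolation[of S v] assms finite_subset[OF assms(1)] by blast
  have "(\<Sum>l<m. coeff f l * z ^ (i * l)) = poly f (z ^ i)" for i
  proof -
    have "poly f (z ^ i) = (\<Sum>l\<le>max m (degree f). coeff f l * (z ^ i) ^ l)"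
      unfolding poly_altdef by (intro sum.mono_neutral_left) (auto simp: coeff_eq_0)
    also have "\<dots> = (\<Sum>l<m. coeff f l * (z ^ i) ^ l)"
      using f assms by (intro sum.mono_neutral_right) auto
    finally show ?thesis by (simp add: power_mult)
  qed
  then show thesis using f that[of "coeff f"] by simp
qed

end

section \<open>Frobenius, trace and the subfield with \<open>q\<close> elements\<close>

locale quadratic_residues = galois_residues M z "q\<^sup>2" p "2 * e"
  for M :: "'a::comm_ring_1 set" and z :: 'a and q p e :: nat +
  assumes q: "q = p ^ e" and q_ge_3: "q \<ge> 3"
begin

abbreviation N :: nat where "N \<equiv> q\<^sup>2 - 1"

lemma N_eq: "N = (q + 1) * (q - 1)"
  using q_ge_3 by (simp add: power2_eq_square algebra_simps)

lemma frobenius_add: "(a + b) ^ q \<doteq> a ^ q + b ^ q"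
  unfolding q by (rule freshmans_dream_eqv'[OF prime_p of_nat_p])

lemma zero_power_q [simp]: "0 ^ q = (0 :: 'a)"
  using q_ge_3 by (simp add: zero_power)

lemma frobenius_sum: "(sum f A) ^ q \<doteq> (\<Sum>i\<in>A. f i ^ q)"
proof (induction A rule: infinite_finite_induct)
  case (insert x A)
  have "(f x + sum f A) ^ q \<doteq> f x ^ q + (sum f A) ^ q" by (rule frobenius_add)
  also have "\<dots> \<doteq> f x ^ q + (\<Sum>i\<in>A. f i ^ q)" using insert by (intro eqv_add) auto
  finally show ?case using insert by simp
qed auto

lemma frobenius_uminus: "(- a) ^ q \<doteq> - (a ^ q)"
proof -
  have "(- a) ^ q + a ^ q \<doteq> (- a + a) ^ q" by (rule eqv_sym) (rule frobenius_add)
  then show ?thesis by (simp add: eqv_def)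
qed

lemma frobenius_twice: "(a ^ q) ^ q \<doteq> a"
proof -
  have "a ^ q\<^sup>2 \<doteq> a"
  proof (cases "a \<doteq> 0")
    case True
    then have "a ^ q\<^sup>2 \<doteq> 0" using eqv_power[OF True, of "q\<^sup>2"] q_ge_3 by (simp add: zero_power)
    then show ?thesis using eqv_sym[OF True] by (rule eqv_trans)
  next
    case False
    then obtain i where i: "a \<doteq> z ^ i" using exhaust_power by blast
    have "(z ^ i) ^ q\<^sup>2 = z ^ (i + N * i)"
      using q_ge_3 by (simp add: power_mult[symmetric] algebra_simps)
    also have "\<dots> \<doteq> z ^ i" by (rule power_add_mult_root)
    finally show ?thesis using i eqv_power[OF i] eqv_sym eqv_trans by blast
  qed
  then show ?thesis by (simp add: power2_eq_square power_mult)
qed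

text \<open>Membership in the subfield with \<open>q\<close> elements, as the fixed field of
  Frobenius.\<close>

definition fixed :: "'a \<Rightarrow> bool" where
  "fixed a \<longleftrightarrow> a ^ q \<doteq> a"

definition tr :: "'a \<Rightarrow> 'a" where
  "tr a = a + a ^ q"

lemma fixed_add: "fixed a \<Longrightarrow> fixed b \<Longrightarrow> fixed (a + b)"
  unfolding fixed_def using frobenius_add eqv_add eqv_trans by blast

lemma fixed_uminus: "fixed a \<Longrightarrow> fixed (- a)"
  unfolding fixed_def using frobenius_uminus eqv_uminus eqv_trans by blast

lemma fixed_diff: "fixed a \<Longrightarrow> fixed b \<Longrightarrow> fixed (a - b)"
  using fixed_add[of a "- b"] fixed_uminus by simp

lemma fixed_0: "fixed 0"
  by (simp add: fixed_def)

lemma fixed_mult: "fixed a \<Longrightarrow> fixed b \<Longrightarrow> fixed (a * b)"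
  unfolding fixed_def power_mult_distrib by (rule eqv_mult)

lemma fixed_sum: "(\<And>i. i \<in> A \<Longrightarrow> fixed (f i)) \<Longrightarrow> fixed (sum f A)"
  by (induction A rule: infinite_finite_induct) (auto intro: fixed_0 fixed_add)

lemma fixed_tr: "fixed (tr a)"
proof -
  have "(a + a ^ q) ^ q \<doteq> a ^ q + (a ^ q) ^ q" by (rule frobenius_add)
  also have "\<dots> \<doteq> a ^ q + a" by (intro eqv_add frobenius_twice) auto
  finally show ?thesis by (simp add: fixed_def tr_def add.commute)
qed

text \<open>\<open>z ^ (q + 1)\<close> is the norm of \<open>z\<close>: multiplying its exponent by
  \<open>q\<close> changes it by a multiple of \<open>N\<close>.\<close>

lemma fixed_norm: "fixed (z ^ ((q + 1) * i))"
proof -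
  have "(q + 1) * q = (q + 1) + N"
    using q_ge_3 by (simp add: power2_eq_square algebra_simps)
  then have "(q + 1) * i * q = (q + 1) * i + N * i"
    by (metis add_mult_distrib mult.assoc mult.commute)
  then show ?thesis unfolding fixed_def
    by (simp only: power_mult[symmetric] power_add_mult_root)
qed

lemma tr_cong: "a \<doteq> b \<Longrightarrow> tr a \<doteq> tr b"
  unfolding tr_def by (intro eqv_add eqv_power)

lemma tr_0 [simp]: "tr 0 = 0"
  by (simp add: tr_def)

lemma tr_add: "tr (a + b) \<doteq> tr a + tr b"
  using eqv_add[OF eqv_refl[of "a + b"] frobenius_add[of a b]] by (simp add: tr_def algebra_simps)

lemma tr_uminus: "tr (- a) \<doteq> - tr a"
  using eqv_add[OF eqv_refl[of "- a"] frobenius_uminus[of a]] by (simp add: tr_def)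

lemma tr_mult_fixed: "fixed b \<Longrightarrow> tr (a * b) \<doteq> tr a * b"
  using eqv_add[OF eqv_refl[of "a * b"] eqv_mult[OF eqv_refl[of "a ^ q"], of "b ^ q" b]]
  by (simp add: fixed_def tr_def power_mult_distrib distrib_right)

text \<open>A nonzero trace lies in the subfield together with its inverse, so linearity of the
  trace over the subfield allows scaling it to 1.\<close>

lemma exists_tr_eqv_1: "\<exists>\<theta>. tr \<theta> \<doteq> 1"
proof -
  obtain a where a: "\<not> tr a \<doteq> 0"
  proof (rule ccontr)
    assume neg: "\<not> thesis"
    have tr0: "tr a \<doteq> 0" for a using that neg by blast
    \<comment> \<open>If all traces vanish, that of 1 shows that 2 is 0, and that of
      \<open>z\<close> then makes \<open>z ^ q\<close> equal to \<open>z\<close>, although the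
      powers below \<open>N\<close> are distinct.\<close>
    have "1 + 1 \<doteq> 0" using tr0[of 1] by (simp add: tr_def)
    then have "(1 + 1) * z \<doteq> 0 * z" by (intro eqv_mult) auto
    then have "z ^ q + z - (1 + 1) * z \<doteq> 0 - 0"
      using tr0[of z] by (intro eqv_diff) (auto simp: tr_def add.commute)
    then have "z ^ q \<doteq> z ^ 1" by (simp add: eqv_def algebra_simps)
    moreover have "q < N"
    proof -
      have "q * 3 \<le> q * q" using q_ge_3 by (intro mult_left_mono) auto
      then show ?thesis using q_ge_3 unfolding power2_eq_square by linarith
    qed
    ultimately have "q = 1" using q_ge_3 by (intro inj_power) auto
    then show False using q_ge_3 by simp
  qed
  then obtain b where b: "b * tr a \<doteq> 1" by (rule inverse_eqv)
  \<comment> \<open>Frobenius fixes \<open>tr a\<close>, hence also its inverse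
    \<open>b\<close>.\<close>
  have "b ^ q * tr a \<doteq> b ^ q * (tr a) ^ q"
    using fixed_tr[of a] by (intro eqv_mult) (auto simp: fixed_def eqv_sym)
  also have "\<dots> = (b * tr a) ^ q" by (simp add: power_mult_distrib)
  also have "\<dots> \<doteq> 1 ^ q" by (rule eqv_power[OF b])
  also have "1 ^ q \<doteq> b * tr a" using eqv_sym[OF b] by simp
  finally have "tr a * b ^ q \<doteq> tr a * b" by (simp add: mult.commute)
  then have "fixed b" using a eqv_mult_left_cancel by (auto simp: fixed_def)
  then have "tr (a * b) \<doteq> tr a * b" by (rule tr_mult_fixed)
  also have "\<dots> \<doteq> 1" using b by (simp add: mult.commute)
  finally show ?thesis by blast
qed

text \<open>The digits \<open>0, \<dots>, q - 1\<close> encode the subfield with \<open>q\<close> elements, whose nonzero elements are the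
  powers of the norm \<open>z ^ (q + 1)\<close>.\<close>

definition \<kappa> :: "nat \<Rightarrow> 'a" where
  "\<kappa> t = (if t = 0 then 0 else z ^ ((q + 1) * (t - 1)))"

lemma fixed_\<kappa>: "fixed (\<kappa> t)"
  by (cases "t = 0") (simp_all only: \<kappa>_def if_True if_False simp_thms fixed_norm fixed_0)

lemma \<kappa>_inj: "\<lbrakk>s < q; t < q; \<kappa> s \<doteq> \<kappa> t\<rbrakk> \<Longrightarrow> s = t"
proof -
  assume st: "s < q" "t < q" "\<kappa> s \<doteq> \<kappa> t"
  have lt: "(q + 1) * (t - 1) < N" if "t < q" "t \<noteq> 0" for t
    unfolding N_eq using that by (intro mult_strict_left_mono) auto
  show "s = t"
  proof (cases "s = 0 \<or> t = 0")
    case True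
    then show ?thesis
      using st not_power_eqv_0 eqv_sym[of 0] by (simp add: \<kappa>_def split: if_splits) blast+
  next
    case False
    then have "(q + 1) * (s - 1) = (q + 1) * (t - 1)"
      using st lt by (intro inj_power) (auto simp: \<kappa>_def)
    then have "s - 1 = t - 1" by (metis mult_cancel1 add_is_0 one_neq_zero)
    then show ?thesis using False by arith
  qed
qed

text \<open>If \<open>z ^ i\<close> is fixed, then \<open>z ^ (i * (q - 1))\<close> is 1, so
  \<open>N = (q + 1) * (q - 1)\<close> divides \<open>i * (q - 1)\<close> and \<open>q + 1\<close>
  divides \<open>i\<close>.\<close>

lemma \<kappa>_exhaust:
  assumes "fixed a"
  shows "\<exists>t<q. a \<doteq> \<kappa> t"
proof (cases "a \<doteq> 0")
  case True
  then show ?thesis using q_ge_3 by (intro exI[of _ 0]) (auto simp: \<kappa>_def)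
next
  case False
  then obtain i where i: "i < N" "a \<doteq> z ^ i" using exhaust_power by blast
  have "z ^ (i * q) \<doteq> z ^ i"
    using assms i eqv_power[OF i(2), of q] eqv_sym eqv_trans
    unfolding fixed_def power_mult by meson
  moreover have "i * q = i + i * (q - 1)" using q_ge_3 by (simp add: algebra_simps)
  ultimately have "z ^ i * z ^ (i * (q - 1)) \<doteq> z ^ i * 1" by (simp add: power_add)
  then have "z ^ (i * (q - 1)) \<doteq> 1" using not_power_eqv_0 eqv_mult_left_cancel by blast
  then have "(q + 1) * (q - 1) dvd i * (q - 1)" by (simp only: power_eqv_one_iff N_eq)
  then have "(q - 1) * (q + 1) dvd (q - 1) * i" by (simp only: mult.commute)
  then have "q + 1 dvd i" using q_ge_3 unfolding nat_mult_dvd_cancel_disj by auto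
  then obtain s where s: "i = (q + 1) * s" by blast
  have "(q + 1) * s < (q + 1) * (q - 1)" using i(1) unfolding s N_eq .
  then have "s < q - 1" by (simp only: mult_less_cancel1)
  \<comment> \<open>The shift by one leaves the digit 0 for the zero element.\<close>
  then show ?thesis using i(2) s by (intro exI[of _ "Suc s"]) (auto simp: \<kappa>_def)
qed

definition digit :: "'a \<Rightarrow> nat" where
  "digit a = (SOME t. t < q \<and> a \<doteq> \<kappa> t)"

lemma digit: "fixed a \<Longrightarrow> digit a < q" "fixed a \<Longrightarrow> \<kappa> (digit a) \<doteq> a"
  using someI_ex[of "\<lambda>t. t < q \<and> a \<doteq> \<kappa> t"] \<kappa>_exhaust[of a] eqv_sym
  unfolding digit_def by auto

text \<open>Encodes a vector over the subfield as a basis index; on such vectors it inverts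
  \<open>\<kappa>\<close> coordinatewise.\<close>

definition word :: "(nat \<Rightarrow> 'a) \<Rightarrow> qword" where
  "word a = (\<lambda>i\<in>{..<N}. digit (a i))"

lemma word_in_qwords: "(\<And>i. i < N \<Longrightarrow> fixed (a i)) \<Longrightarrow> word a \<in> qwords q N"
  by (auto simp: word_def qwords_def digit)

lemma \<kappa>_word: "(\<And>i. i < N \<Longrightarrow> fixed (a i)) \<Longrightarrow> i < N \<Longrightarrow> \<kappa> (word a i) \<doteq> a i"
  by (simp add: word_def digit)

lemma qwords_eqI:
  assumes "x \<in> qwords q N" "y \<in> qwords q N" "\<And>i. i < N \<Longrightarrow> \<kappa> (x i) \<doteq> \<kappa> (y i)"
  shows "x = y"
  using assms unfolding qwords_def by (intro PiE_ext[of x _ _ y]) (auto intro!: \<kappa>_inj intro: eqv_sym simp: PiE_iff)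

end

section \<open>The trace code\<close>

text \<open>Modulo \<open>n\<close> the sum is \<open>j - i\<close>, whose absolute value is below
  \<open>n\<close>. It serves exponents in which \<open>z ^ (N - 1)\<close> replaces the inverse of
  \<open>z\<close>.\<close>

lemma dvd_pred_mult_add_iff:
  fixes i j n :: nat
  assumes "i < n" "j < n"
  shows "n dvd (n - 1) * i + j \<longleftrightarrow> j = i"
proof -
  have "(n - 1) * i + j = n * i + j - i" using assms by (simp add: diff_mult_distrib)
  moreover have "i \<le> n * i" using assms by (cases n) auto
  then have "int (n * i + j - i) = int (n * i + j) - int i" by (intro of_nat_diff) linarith
  ultimately have "int ((n - 1) * i + j) = int n * int i + (int j - int i)" by simp
  then have "n dvd (n - 1) * i + j \<longleftrightarrow> int n dvd int j - int i"
    by (metis dvd_add_right_iff dvd_triv_left int_dvd_int_iff)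
  also have "\<dots> \<longleftrightarrow> j = i"
    using assms dvd_imp_le_int[of "int j - int i" "int n"] by fastforce
  finally show ?thesis .
qed

locale trace_code = quadratic_residues +
  fixes c :: nat
  assumes c: "2 \<le> c" "c < q"
begin

lemma q_times_less: "l < c - 1 \<Longrightarrow> q * l < N"
proof -
  assume "l < c - 1"
  then have "q * l \<le> q * (q - 1)" using c by (intro mult_le_mono2) linarith
  also have "\<dots> < (q + 1) * (q - 1)" using q_ge_3 by simp
  finally show "q * l < N" by (simp only: N_eq)
qed

lemma less_N: "l < q \<Longrightarrow> l < N"
proof -
  assume "l < q"
  have "q * 1 \<le> q * (q - 1)" using q_ge_3 by (intro mult_le_mono2) linarith
  also have "\<dots> < (q + 1) * (q - 1)" using q_ge_3 by simp
  finally show "l < N" using \<open>l < q\<close> by (simp only: N_eq)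
qed

text \<open>The word of values Tr f(x) for a polynomial of degree at most \<open>c - 2\<close>:
  \<open>b = 1\<close> gives the code D, while \<open>b = N - 1\<close> evaluates at the inverse
  points.\<close>

definition trace_vec :: "nat \<Rightarrow> (nat \<Rightarrow> 'a) \<Rightarrow> nat \<Rightarrow> 'a" where
  "trace_vec b f i = tr (\<Sum>l<c - 1. f l * ((z ^ b) ^ i) ^ l)"

lemma fixed_trace_vec: "fixed (trace_vec b f i)"
  by (simp add: trace_vec_def fixed_tr)

lemma trace_vec_add: "trace_vec b (\<lambda>l. f l + g l) i \<doteq> trace_vec b f i + trace_vec b g i"
  unfolding trace_vec_def distrib_right sum.distrib by (rule tr_add)

lemma trace_vec_uminus: "trace_vec b (\<lambda>l. - f l) i \<doteq> - trace_vec b f i"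
  unfolding trace_vec_def mult_minus_left sum_negf by (rule tr_uminus)

lemma trace_vec_0 [simp]: "trace_vec b (\<lambda>l. 0) i = 0"
  by (simp add: trace_vec_def)

text \<open>The constant coefficient contributes its trace to every entry, so it matters only
  through that trace.\<close>

lemma trace_vec_cong:
  assumes "tr (f 0) \<doteq> tr (g 0)" "\<And>l. 0 < l \<Longrightarrow> l < c - 1 \<Longrightarrow> f l \<doteq> g l"
  shows "trace_vec b f i \<doteq> trace_vec b g i"
proof -
  define a where "a = (z ^ b) ^ i"
  have split: "(\<Sum>l<c - 1. h l * a ^ l) = h 0 + (\<Sum>l<c - 2. h (Suc l) * a ^ Suc l)" for h
  proof -
    have "c - 1 = Suc (c - 2)" using c by simp
    then show ?thesis by (simp only: sum.lessThan_Suc_shift) simp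
  qed
  have "trace_vec b f i \<doteq> tr (f 0) + tr (\<Sum>l<c - 2. f (Suc l) * a ^ Suc l)"
    unfolding trace_vec_def a_def[symmetric] split by (rule tr_add)
  also have "\<dots> \<doteq> tr (g 0) + tr (\<Sum>l<c - 2. g (Suc l) * a ^ Suc l)"
  proof (rule eqv_add[OF assms(1)], rule tr_cong, rule eqv_sum)
    show "f (Suc l) * a ^ Suc l \<doteq> g (Suc l) * a ^ Suc l" if "l \<in> {..<c - 2}" for l
      using assms(2)[of "Suc l"] that by (intro eqv_mult) auto
  qed
  also have "\<dots> \<doteq> trace_vec b g i"
    unfolding trace_vec_def a_def[symmetric] split by (rule eqv_sym, rule tr_add)
  finally show ?thesis .
qed

text \<open>Expanding the trace splits each coefficient into two monomials, \<open>f l\<close> at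
  exponent \<open>a + b * l\<close> and its conjugate at \<open>a + b * (q * l)\<close>; the power
  sums keep only exponents divisible by \<open>N\<close>.\<close>

lemma sum_trace_vec:
  "(\<Sum>i<N. (z ^ a) ^ i * trace_vec b f i) \<doteq>
     (\<Sum>l<c - 1. f l * (if N dvd a + b * l then -1 else 0)
              + f l ^ q * (if N dvd a + b * (q * l) then -1 else 0))"
proof -
  have pow: "(z ^ a) ^ i * ((z ^ b) ^ i) ^ l = (z ^ (a + b * l)) ^ i" for i l
    unfolding power_mult[symmetric] power_add[symmetric] by (simp add: algebra_simps)
  have "(\<Sum>i<N. (z ^ a) ^ i * trace_vec b f i) \<doteq>
      (\<Sum>i<N. (z ^ a) ^ i * ((\<Sum>l<c - 1. f l * ((z ^ b) ^ i) ^ l) + (\<Sum>l<c - 1. (f l * ((z ^ b) ^ i) ^ l) ^ q)))"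
    unfolding trace_vec_def tr_def by (intro eqv_sum eqv_mult eqv_add frobenius_sum) auto
  also have "\<dots> = (\<Sum>i<N. \<Sum>l<c - 1. f l * (z ^ (a + b * l)) ^ i + f l ^ q * (z ^ (a + b * (q * l))) ^ i)"
  proof (rule sum.cong[OF refl])
    fix i
    have "(z ^ a) ^ i * (f l * ((z ^ b) ^ i) ^ l) = f l * (z ^ (a + b * l)) ^ i" for l
      by (simp only: pow[symmetric] mult_ac)
    moreover have "(z ^ a) ^ i * (f l * ((z ^ b) ^ i) ^ l) ^ q = f l ^ q * (z ^ (a + b * (q * l))) ^ i" for l
    proof -
      have "(f l * ((z ^ b) ^ i) ^ l) ^ q = f l ^ q * ((z ^ b) ^ i) ^ (q * l)"
        unfolding power_mult_distrib power_mult[symmetric] by (simp add: mult_ac)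
      then show ?thesis by (simp only: pow[symmetric] mult_ac)
    qed
    ultimately show "(z ^ a) ^ i * ((\<Sum>l<c - 1. f l * ((z ^ b) ^ i) ^ l) + (\<Sum>l<c - 1. (f l * ((z ^ b) ^ i) ^ l) ^ q))
        = (\<Sum>l<c - 1. f l * (z ^ (a + b * l)) ^ i + f l ^ q * (z ^ (a + b * (q * l))) ^ i)"
      by (simp only: distrib_left sum_distrib_left sum.distrib)
  qed
  also have "\<dots> = (\<Sum>l<c - 1. \<Sum>i<N. f l * (z ^ (a + b * l)) ^ i + f l ^ q * (z ^ (a + b * (q * l))) ^ i)"
    by (rule sum.swap)
  also have "\<dots> = (\<Sum>l<c - 1. f l * (\<Sum>i<N. (z ^ (a + b * l)) ^ i) + f l ^ q * (\<Sum>i<N. (z ^ (a + b * (q * l))) ^ i))"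
    by (simp only: sum.distrib sum_distrib_left)
  also have "\<dots> \<doteq> (\<Sum>l<c - 1. f l * (if N dvd a + b * l then -1 else 0)
              + f l ^ q * (if N dvd a + b * (q * l) then -1 else 0))"
    by (intro eqv_sum eqv_add eqv_mult sum_powers eqv_refl)
  finally show ?thesis .
qed

text \<open>As \<open>k < q\<close>, a conjugate monomial meets \<open>k\<close> only for
  \<open>l = k = 0\<close>. So the constant coefficient is seen together with its conjugate, as its
  trace, and every other coefficient alone.\<close>

lemma sum_trace_vec_inversion:
  assumes k: "k < c - 1"
    and dvd1: "\<And>l. l < c - 1 \<Longrightarrow> N dvd a + b * l \<longleftrightarrow> l = k"
    and dvd2: "\<And>l. l < c - 1 \<Longrightarrow> N dvd a + b * (q * l) \<longleftrightarrow> q * l = k"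
  shows "(\<Sum>i<N. (z ^ a) ^ i * trace_vec b f i) \<doteq> - (if k = 0 then tr (f 0) else f k)"
proof -
  have "(\<Sum>l<c - 1. f l * (if N dvd a + b * l then -1 else 0)
              + f l ^ q * (if N dvd a + b * (q * l) then -1 else 0))
      = (\<Sum>l<c - 1. if l = k then - (if k = 0 then tr (f 0) else f k) else 0)"
  proof (rule sum.cong[OF refl])
    fix l assume "l \<in> {..<c - 1}"
    moreover have "q * l = k \<longleftrightarrow> l = 0 \<and> k = 0" using k c by (cases l) auto
    ultimately show "f l * (if N dvd a + b * l then -1 else 0)
              + f l ^ q * (if N dvd a + b * (q * l) then -1 else 0)
        = (if l = k then - (if k = 0 then tr (f 0) else f k) else 0)"
      using dvd1[of l] dvd2[of l] by (auto simp: tr_def)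
  qed
  also have "\<dots> = - (if k = 0 then tr (f 0) else f k)" using k by simp
  finally show ?thesis using sum_trace_vec[of a b f] by (simp only:)
qed

section \<open>Syndromes and messages\<close>

text \<open>The parity checks of C: the weighted pairing with \<open>x^k\<close> at
  \<open>x = z^i\<close>. For entries in the subfield the pairing with Tr f is the trace of the sum
  of \<open>f l * syndrome a l\<close>, so vanishing syndromes mean duality to D.\<close>

definition syndrome :: "(nat \<Rightarrow> 'a) \<Rightarrow> nat \<Rightarrow> 'a" where
  "syndrome a k = (\<Sum>i<N. (z ^ (q + 1 + k)) ^ i * a i)"

lemma syndrome_cong: "(\<And>i. i < N \<Longrightarrow> a i \<doteq> b i) \<Longrightarrow> syndrome a k \<doteq> syndrome b k"
  unfolding syndrome_def by (intro eqv_sum eqv_mult) auto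

lemma syndrome_add: "syndrome (\<lambda>i. a i + b i) k = syndrome a k + syndrome b k"
  by (simp add: syndrome_def distrib_left sum.distrib)

lemma syndrome_diff: "syndrome (\<lambda>i. a i - b i) k = syndrome a k - syndrome b k"
  by (simp add: syndrome_def right_diff_distrib sum_subtractf)

text \<open>For \<open>k = 0\<close> only the weights are left, and these are norms. This matches
  the smaller range of entry 0 of a message.\<close>

lemma fixed_syndrome_0: "(\<And>i. i < N \<Longrightarrow> fixed (a i)) \<Longrightarrow> fixed (syndrome a 0)"
  unfolding syndrome_def
  by (intro fixed_sum fixed_mult) (use fixed_norm in \<open>auto simp del: power_Suc simp flip: power_mult\<close>)

text \<open>All exponents occurring in a syndrome of a trace word lie strictly between
  \<open>0\<close> and \<open>q\<^sup>2 - 1\<close>, so the trace code is self-orthogonal for the weights \<open>z ^ ((q + 1) * i)\<close>.\<close>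

lemma syndrome_trace_vec: "k < c - 1 \<Longrightarrow> syndrome (trace_vec 1 f) k \<doteq> 0"
proof -
  assume k: "k < c - 1"
  have "\<not> N dvd q + 1 + k + 1 * l" "\<not> N dvd q + 1 + k + 1 * (q * l)" if l: "l < c - 1" for l
  proof -
    have kl: "k \<le> q - 3" "l \<le> q - 3" using k l c by auto
    \<comment> \<open>Writing \<open>q = r + 3\<close> removes the subtractions, so that linear
      arithmetic can bound both exponents by \<open>N\<close>.\<close>
    obtain r where r: "q = r + 3" using q_ge_3 by (metis add.commute le_Suc_ex)
    have N: "N = r * r + 6 * r + 8" by (simp add: r power2_eq_square algebra_simps)
    have "q * l \<le> q * r" using kl r by (intro mult_le_mono2) simp
    then have "q * l \<le> r * r + 3 * r" by (simp add: r algebra_simps)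
    then have "q + 1 + k + 1 * (q * l) < N" "q + 1 + k + 1 * l < N"
      using kl r unfolding N by linarith+
    then show "\<not> N dvd q + 1 + k + 1 * l" "\<not> N dvd q + 1 + k + 1 * (q * l)"
      by (auto dest!: dvd_imp_le)
  qed
  then have "(\<Sum>l<c - 1. f l * (if N dvd q + 1 + k + 1 * l then -1 else 0)
              + f l ^ q * (if N dvd q + 1 + k + 1 * (q * l) then -1 else 0)) = 0"
    by (intro sum.neutral ballI) (simp only: lessThan_iff if_False mult_zero_right add_0_left)
  then show ?thesis unfolding syndrome_def using sum_trace_vec[of "q + 1 + k" 1 f] by (simp only:)
qed

text \<open>The exponent \<open>(N - 1) * k\<close> stands for \<open>- k\<close>: pairing with
  \<open>x^(-k)\<close> reads off the coefficient of \<open>x^k\<close>.\<close>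

lemma trace_vec_recover:
  assumes k: "k < c - 1"
  shows "(\<Sum>i<N. (z ^ ((N - 1) * k)) ^ i * trace_vec 1 f i) \<doteq> - (if k = 0 then tr (f 0) else f k)"
proof (rule sum_trace_vec_inversion[OF k])
  fix l assume l: "l < c - 1"
  show "N dvd (N - 1) * k + 1 * l \<longleftrightarrow> l = k"
    using dvd_pred_mult_add_iff[of k N l] less_N[of k] less_N[of l] k l c by simp
  show "N dvd (N - 1) * k + 1 * (q * l) \<longleftrightarrow> q * l = k"
    using dvd_pred_mult_add_iff[of k N "q * l"] less_N[of k] q_times_less[OF l] k c by simp
qed

text \<open>A word with prescribed syndrome: \<open>z ^ (N - 1)\<close> stands for the inverse of \<open>z\<close>, so this is the word
  \<open>x\<^sup>-\<^sup>q\<^sup>-\<^sup>1 Tr f(x\<^sup>-\<^sup>1)\<close>.\<close>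

definition syndrome_leader :: "(nat \<Rightarrow> 'a) \<Rightarrow> nat \<Rightarrow> 'a" where
  "syndrome_leader f i = (z ^ ((q + 1) * (N - 1))) ^ i * trace_vec (N - 1) f i"

lemma fixed_syndrome_leader: "fixed (syndrome_leader f i)"
  unfolding syndrome_leader_def power_mult[symmetric] mult.assoc
  by (intro fixed_mult fixed_norm fixed_trace_vec)

text \<open>The leader's factors \<open>x^(-q-1)\<close> cancel the weights, and pairing
  \<open>x^k\<close> with the trace of f at the inverse of x reads off coefficient
  \<open>k\<close>.\<close>

lemma syndrome_syndrome_leader:
  assumes k: "k < c - 1"
  shows "syndrome (syndrome_leader f) k \<doteq> - (if k = 0 then tr (f 0) else f k)"
proof -
  have Npos: "N > 0" using less_N[of 0] q_ge_3 by simp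
  have "q + 1 + k + (q + 1) * (N - 1) = k + (q + 1) * Suc (N - 1)" by simp
  also have "Suc (N - 1) = N" using Npos by simp
  finally have e: "q + 1 + k + (q + 1) * (N - 1) = k + (q + 1) * N" .
  have "(z ^ (q + 1 + k)) ^ i * (z ^ ((q + 1) * (N - 1))) ^ i = (z ^ (k + (q + 1) * N)) ^ i" for i
    by (simp only: power_mult_distrib[symmetric] power_add[symmetric] e)
  then have "syndrome (syndrome_leader f) k
      = (\<Sum>i<N. (z ^ (k + (q + 1) * N)) ^ i * trace_vec (N - 1) f i)"
    unfolding syndrome_def syndrome_leader_def by (simp only: mult.assoc[symmetric])
  also have "\<dots> \<doteq> - (if k = 0 then tr (f 0) else f k)"
  proof (rule sum_trace_vec_inversion[OF k])
    fix l assume l: "l < c - 1"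
    have dvd: "N dvd k + (q + 1) * N + x \<longleftrightarrow> N dvd x + k" for x
    proof -
      have "k + (q + 1) * N + x = (q + 1) * N + (x + k)" by simp
      then show ?thesis by (simp only: dvd_add_right_iff dvd_triv_right)
    qed
    show "N dvd k + (q + 1) * N + (N - 1) * l \<longleftrightarrow> l = k"
      unfolding dvd using dvd_pred_mult_add_iff[of l N k] less_N[of k] less_N[of l] k l c by auto
    show "N dvd k + (q + 1) * N + (N - 1) * (q * l) \<longleftrightarrow> q * l = k"
      unfolding dvd using dvd_pred_mult_add_iff[of "q * l" N k] less_N[of k] q_times_less[OF l] k c by auto
  qed
  finally show ?thesis .
qed

definition \<theta> :: 'a where
  "\<theta> = (SOME a. tr a \<doteq> 1)"

lemma tr_\<theta>: "fixed a \<Longrightarrow> tr (\<theta> * a) \<doteq> a"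
proof -
  assume "fixed a"
  then have "tr (\<theta> * a) \<doteq> tr \<theta> * a" by (rule tr_mult_fixed)
  also have "\<dots> \<doteq> 1 * a"
    using someI_ex[OF exists_tr_eqv_1] by (intro eqv_mult) (auto simp: \<theta>_def)
  finally show ?thesis by simp
qed

text \<open>A trace word determines its polynomial up to changing the constant coefficient by an element
  of trace zero.  Messages therefore have their entry \<open>0\<close> in the subfield, and \<open>lift\<close> multiplies that
  entry by an element of trace one.\<close>

definition messages :: "(nat \<Rightarrow> 'a) set" where
  "messages = (\<Pi>\<^sub>E l\<in>{..<c - 1}. if l = 0 then \<kappa> ` {..<q} else residues)"

definition lift :: "(nat \<Rightarrow> 'a) \<Rightarrow> nat \<Rightarrow> 'a" where
  "lift t l = (if l = 0 then \<theta> * t 0 else t l)"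

lemma message_cases:
  assumes "t \<in> messages"
  obtains s where "s < q" "t 0 = \<kappa> s"
  using assms c unfolding messages_def PiE_iff by (metis Suc_1 Suc_le_eq imageE lessThan_iff zero_less_diff)

lemma lift_recover:
  assumes "t \<in> messages"
  shows "(if k = 0 then tr (lift t 0) else lift t k) \<doteq> t k"
proof -
  obtain s where "t 0 = \<kappa> s" using message_cases[OF assms] by blast
  then have "fixed (t 0)" by (simp add: fixed_\<kappa>)
  then show ?thesis by (simp add: lift_def tr_\<theta>)
qed

lemma card_messages: "card messages = q ^ (2 * c - 3)"
proof -
  have "inj_on \<kappa> {..<q}" using \<kappa>_inj by (intro inj_onI) auto
  then have "card messages = (\<Prod>l<c - 1. if l = 0 then q else q\<^sup>2)"
    unfolding messages_def
    by (subst card_PiE) (auto simp: card_image card_residues intro!: prod.cong)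
  also have "c - 1 = Suc (c - 2)" using c by simp
  also have "(\<Prod>l<Suc (c - 2). if l = 0 then q else q\<^sup>2) = q * (q\<^sup>2) ^ (c - 2)" by (simp only: prod.lessThan_Suc_shift) simp
  also have "\<dots> = q ^ (2 * c - 3)"
  proof -
    have "2 * c - 3 = Suc (2 * (c - 2))" using c by simp
    then show ?thesis by (simp only: power_Suc power_mult)
  qed
  finally show ?thesis .
qed

lemma messages_eqI:
  assumes "s \<in> messages" "t \<in> messages" "\<And>k. k < c - 1 \<Longrightarrow> s k \<doteq> t k"
  shows "s = t"
  using assms(1,2) unfolding messages_def
proof (rule PiE_ext)
  fix k assume k: "k \<in> {..<c - 1}"
  then have "s k \<doteq> t k" using assms(3) by simp
  moreover have "s k \<in> (if k = 0 then \<kappa> ` {..<q} else residues)" "t k \<in> (if k = 0 then \<kappa> ` {..<q} else residues)"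
    using assms(1,2) k by (auto simp: messages_def PiE_iff)
  ultimately show "s k = t k" using residues_inj \<kappa>_inj by (cases "k = 0") force+
qed

lemma exists_message:
  assumes "fixed (a 0)"
  obtains t where "t \<in> messages" "\<And>k. k < c - 1 \<Longrightarrow> t k \<doteq> a k"
proof -
  have "\<exists>t. t \<in> (if k = 0 then \<kappa> ` {..<q} else residues) \<and> t \<doteq> a k" for k
    using residues_exhaust[of "a k"] \<kappa>_exhaust[OF assms] eqv_sym by (cases "k = 0") auto
  then obtain t where t: "\<And>k. t k \<in> (if k = 0 then \<kappa> ` {..<q} else residues) \<and> t k \<doteq> a k" by metis
  show thesis
    using t by (intro that[of "restrict t {..<c - 1}"]) (auto simp: messages_def PiE_iff)
qed

section \<open>The dual code C and the cosets of D\<close>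

definition codewords :: "qword set" where
  "codewords = {x \<in> qwords q N. \<forall>k<c - 1. syndrome (\<lambda>i. \<kappa> (x i)) k \<doteq> 0}"

text \<open>Congruence modulo D, taken on images under \<open>\<kappa>\<close> because the digits
  carry no field subtraction.\<close>

definition coset_rel :: "qword rel" where
  "coset_rel = {(x, y). x \<in> codewords \<and> y \<in> codewords \<and> (\<exists>f. \<forall>i<N. \<kappa> (y i) - \<kappa> (x i) \<doteq> trace_vec 1 f i)}"

lemma equiv_coset_rel: "equiv codewords coset_rel"
proof (rule equivI)
  show "coset_rel \<subseteq> codewords \<times> codewords" by (auto simp: coset_rel_def)
  show "refl_on codewords coset_rel" by (auto simp: coset_rel_def refl_on_def intro!: exI[of _ "\<lambda>_. 0"])
  show "sym coset_rel"
  proof (rule symI)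
    fix x y assume "(x, y) \<in> coset_rel"
    then obtain f where f: "x \<in> codewords" "y \<in> codewords" "\<forall>i<N. \<kappa> (y i) - \<kappa> (x i) \<doteq> trace_vec 1 f i"
      by (auto simp: coset_rel_def)
    have "\<kappa> (x i) - \<kappa> (y i) \<doteq> trace_vec 1 (\<lambda>l. - f l) i" if "i < N" for i
    proof -
      have "- (\<kappa> (y i) - \<kappa> (x i)) \<doteq> - trace_vec 1 f i" using f that by (intro eqv_uminus) auto
      also have "\<dots> \<doteq> trace_vec 1 (\<lambda>l. - f l) i" by (rule eqv_sym, rule trace_vec_uminus)
      finally show ?thesis by simp
    qed
    then show "(y, x) \<in> coset_rel" using f unfolding coset_rel_def by blast
  qed
  show "trans coset_rel"
  proof (rule transI)
    fix x y w assume "(x, y) \<in> coset_rel" "(y, w) \<in> coset_rel"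
    then obtain f g where fg: "x \<in> codewords" "y \<in> codewords" "w \<in> codewords" "\<forall>i<N. \<kappa> (y i) - \<kappa> (x i) \<doteq> trace_vec 1 f i"
        "\<forall>i<N. \<kappa> (w i) - \<kappa> (y i) \<doteq> trace_vec 1 g i"
      by (auto simp: coset_rel_def)
    have "\<kappa> (w i) - \<kappa> (x i) \<doteq> trace_vec 1 (\<lambda>l. f l + g l) i" if "i < N" for i
    proof -
      have "(\<kappa> (y i) - \<kappa> (x i)) + (\<kappa> (w i) - \<kappa> (y i)) \<doteq> trace_vec 1 f i + trace_vec 1 g i"
        using fg that by (intro eqv_add) auto
      also have "\<dots> \<doteq> trace_vec 1 (\<lambda>l. f l + g l) i" by (rule eqv_sym, rule trace_vec_add)
      finally show ?thesis by simp
    qed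
    then show "(x, w) \<in> coset_rel" using fg unfolding coset_rel_def by blast
  qed
qed

lemma word_in_codewords:
  assumes "\<And>i. i < N \<Longrightarrow> fixed (a i)" "\<And>k. k < c - 1 \<Longrightarrow> syndrome a k \<doteq> 0"
  shows "word a \<in> codewords"
proof -
  have "syndrome (\<lambda>i. \<kappa> (word a i)) k \<doteq> 0" if "k < c - 1" for k
    using syndrome_cong[of "\<lambda>i. \<kappa> (word a i)" a k] \<kappa>_word[of a] assms that eqv_trans by blast
  then show ?thesis using word_in_qwords[of a] assms by (auto simp: codewords_def)
qed

text \<open>Trace words have zero syndromes, so translation by D preserves C.\<close>

lemma translate_in_coset_rel:
  assumes x: "x \<in> codewords"
  shows "(x, word (\<lambda>i. \<kappa> (x i) + trace_vec 1 f i)) \<in> coset_rel"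
proof -
  let ?a = "\<lambda>i. \<kappa> (x i) + trace_vec 1 f i"
  have fx: "fixed (?a i)" for i by (intro fixed_add fixed_\<kappa> fixed_trace_vec)
  have "syndrome ?a k \<doteq> 0 + 0" if "k < c - 1" for k
    unfolding syndrome_add using x that by (intro eqv_add syndrome_trace_vec) (auto simp: codewords_def)
  then have "word ?a \<in> codewords" using fx by (intro word_in_codewords) auto
  moreover have "\<kappa> (word ?a i) - \<kappa> (x i) \<doteq> trace_vec 1 f i" if "i < N" for i
    using eqv_diff[OF \<kappa>_word[of ?a i] eqv_refl[of "\<kappa> (x i)"]] fx that by simp
  ultimately show ?thesis using x unfolding coset_rel_def by blast
qed

text \<open>The class is \<open>x + D\<close>, and messages parametrize D: power sums recover a
  message from its trace word, and a trace word depends on its polynomial only through the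
  message.\<close>

lemma card_class:
  assumes x: "x \<in> codewords"
  shows "card (coset_rel `` {x}) = q ^ (2 * c - 3)"
proof -
  let ?a = "\<lambda>t i. \<kappa> (x i) + trace_vec 1 (lift t) i"
  have fx: "fixed (?a t i)" for t i by (intro fixed_add fixed_\<kappa> fixed_trace_vec)
  have "bij_betw (\<lambda>t. word (?a t)) messages (coset_rel `` {x})"
    unfolding bij_betw_def
  proof
    show "inj_on (\<lambda>t. word (?a t)) messages"
    proof (rule inj_onI)
      fix s t assume st: "s \<in> messages" "t \<in> messages" "word (?a s) = word (?a t)"
      have tv: "trace_vec 1 (lift s) i \<doteq> trace_vec 1 (lift t) i" if "i < N" for i
      proof -
        have "?a s i \<doteq> \<kappa> (word (?a s) i)" using \<kappa>_word[of "?a s" i] fx that eqv_sym by blast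
        also have "\<dots> \<doteq> ?a t i" unfolding st(3) using \<kappa>_word[of "?a t" i] fx that by blast
        finally show ?thesis by (simp only: eqv_add_left_cancel)
      qed
      have "s k \<doteq> t k" if k: "k < c - 1" for k
      proof -
        have "- (if k = 0 then tr (lift s 0) else lift s k)
            \<doteq> (\<Sum>i<N. (z ^ ((N - 1) * k)) ^ i * trace_vec 1 (lift s) i)"
          by (rule eqv_sym, rule trace_vec_recover[OF k])
        also have "\<dots> \<doteq> (\<Sum>i<N. (z ^ ((N - 1) * k)) ^ i * trace_vec 1 (lift t) i)"
          using tv by (intro eqv_sum eqv_mult) auto
        also have "\<dots> \<doteq> - (if k = 0 then tr (lift t 0) else lift t k)"
          by (rule trace_vec_recover[OF k])
        finally have "(if k = 0 then tr (lift s 0) else lift s k) \<doteq> (if k = 0 then tr (lift t 0) else lift t k)"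
          by (simp only: eqv_uminus_iff)
        then show ?thesis
          using lift_recover[OF st(1), of k] lift_recover[OF st(2), of k] eqv_sym eqv_trans by blast
      qed
      then show "s = t" using st by (intro messages_eqI)
    qed
    show "(\<lambda>t. word (?a t)) ` messages = coset_rel `` {x}"
    proof
      show "(\<lambda>t. word (?a t)) ` messages \<subseteq> coset_rel `` {x}" using translate_in_coset_rel[OF x] by auto
      show "coset_rel `` {x} \<subseteq> (\<lambda>t. word (?a t)) ` messages"
      proof
        fix y assume "y \<in> coset_rel `` {x}"
        then obtain f where y: "y \<in> codewords" "\<forall>i<N. \<kappa> (y i) - \<kappa> (x i) \<doteq> trace_vec 1 f i"
          by (auto simp: coset_rel_def)
        \<comment> \<open>The normal form of \<open>f\<close>, with the constant coefficient
          replaced by its trace.\<close>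
        obtain t where t: "t \<in> messages" "\<And>k. k < c - 1 \<Longrightarrow> t k \<doteq> (if k = 0 then tr (f 0) else f k)"
          using exists_message[of "\<lambda>k. if k = 0 then tr (f 0) else f k"] fixed_tr by auto
        have lift: "(if k = 0 then tr (lift t 0) else lift t k) \<doteq> (if k = 0 then tr (f 0) else f k)"
          if "k < c - 1" for k
          using lift_recover[OF t(1)] t(2)[OF that] eqv_trans by blast
        have tv: "trace_vec 1 (lift t) i \<doteq> trace_vec 1 f i" for i
        proof (rule trace_vec_cong)
          show "tr (lift t 0) \<doteq> tr (f 0)" using lift[of 0] c by simp
          show "lift t l \<doteq> f l" if "0 < l" "l < c - 1" for l using lift[of l] that by simp
        qed
        have "y = word (?a t)"
        proof (rule qwords_eqI)
          show "y \<in> qwords q N" using y by (auto simp: codewords_def)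
          show "word (?a t) \<in> qwords q N" using fx by (intro word_in_qwords)
          fix i assume i: "i < N"
          have "\<kappa> (y i) = \<kappa> (x i) + (\<kappa> (y i) - \<kappa> (x i))" by simp
          also have "\<dots> \<doteq> \<kappa> (x i) + trace_vec 1 f i" using y i by (intro eqv_add) auto
          also have "\<dots> \<doteq> ?a t i" using eqv_sym[OF tv] by (intro eqv_add) auto
          also have "\<dots> \<doteq> \<kappa> (word (?a t) i)" using \<kappa>_word[of "?a t" i] fx i eqv_sym by blast
          finally show "\<kappa> (y i) \<doteq> \<kappa> (word (?a t) i)" .
        qed
        then show "y \<in> (\<lambda>t. word (?a t)) ` messages" using t by blast
      qed
    qed
  qed
  then have "card messages = card (coset_rel `` {x})" by (rule bij_betw_same_card)
  then show ?thesis by (simp add: card_messages)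
qed

text \<open>Every word is uniquely a codeword plus a syndrome leader, because the leaders of
  messages realize each possible syndrome exactly once.\<close>

lemma card_codewords: "card codewords * q ^ (2 * c - 3) = q ^ N"
proof -
  let ?a = "\<lambda>(x, t) i. \<kappa> (x i) + syndrome_leader (lift t) i"
  have fx: "fixed (?a u i)" for u i
    by (cases u) (auto intro: fixed_add fixed_\<kappa> fixed_syndrome_leader)
  have kw: "\<kappa> (word (?a u) i) \<doteq> ?a u i" if "i < N" for u i
    using \<kappa>_word[of "?a u" i] fx that by blast
  have leader: "syndrome (syndrome_leader (lift t)) k \<doteq> - t k" if "t \<in> messages" "k < c - 1" for t k
    using syndrome_syndrome_leader[OF that(2)] eqv_uminus[OF lift_recover[OF that(1)]] eqv_trans by blast
  have "bij_betw (\<lambda>u. word (?a u)) (codewords \<times> messages) (qwords q N)"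
    unfolding bij_betw_def
  proof
    show "inj_on (\<lambda>u. word (?a u)) (codewords \<times> messages)"
    proof (rule inj_onI)
      fix u v assume uv: "u \<in> codewords \<times> messages" "v \<in> codewords \<times> messages" "word (?a u) = word (?a v)"
      obtain x s y t where u: "u = (x, s)" and v: "v = (y, t)" by fastforce
      have eq: "?a u i \<doteq> ?a v i" if "i < N" for i
        using eqv_trans[OF eqv_sym[OF kw[OF that, of u]]] kw[OF that, of v] uv(3) by simp
      have "s k \<doteq> t k" if k: "k < c - 1" for k
      proof -
        have syn: "syndrome (?a (x', s')) k \<doteq> - s' k" if "x' \<in> codewords" "s' \<in> messages" for x' s'
        proof -
          have "syndrome (?a (x', s')) k \<doteq> 0 + - s' k"
            unfolding prod.case syndrome_add
            using that k leader by (intro eqv_add) (auto simp: codewords_def)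
          then show ?thesis by simp
        qed
        have "- s k \<doteq> syndrome (?a u) k" using syn[of x s] uv u eqv_sym by simp
        also have "\<dots> \<doteq> syndrome (?a v) k" using eq by (rule syndrome_cong)
        also have "\<dots> \<doteq> - t k" using syn[of y t] uv v by simp
        finally show ?thesis by (simp only: eqv_uminus_iff)
      qed
      then have st: "s = t" using uv u v by (intro messages_eqI) auto
      have "x = y"
      proof (rule qwords_eqI)
        show "x \<in> qwords q N" "y \<in> qwords q N" using uv u v by (auto simp: codewords_def)
        show "\<kappa> (x i) \<doteq> \<kappa> (y i)" if "i < N" for i
          using eq[OF that] unfolding u v st prod.case
          by (simp only: eqv_add_left_cancel add.commute[of "\<kappa> _"])
      qed
      then show "u = v" using st u v by simp
    qed
    show "(\<lambda>u. word (?a u)) ` (codewords \<times> messages) = qwords q N"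
    proof
      show "(\<lambda>u. word (?a u)) ` (codewords \<times> messages) \<subseteq> qwords q N"
        using fx word_in_qwords by blast
      show "qwords q N \<subseteq> (\<lambda>u. word (?a u)) ` (codewords \<times> messages)"
      proof
        fix y assume y: "y \<in> qwords q N"
        define s where "s = syndrome (\<lambda>i. \<kappa> (y i))"
        \<comment> \<open>The leader of \<open>t\<close> has syndrome \<open>- t\<close>, so the
          message sought is the negated syndrome of \<open>y\<close>.\<close>
        have "fixed (- s 0)" unfolding s_def by (intro fixed_uminus fixed_syndrome_0 fixed_\<kappa>)
        then obtain t where t: "t \<in> messages" "\<And>k. k < c - 1 \<Longrightarrow> t k \<doteq> - s k"
          using exists_message[of "\<lambda>k. - s k"] by blast
        let ?b = "\<lambda>i. \<kappa> (y i) - syndrome_leader (lift t) i"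
        have fb: "fixed (?b i)" for i by (intro fixed_diff fixed_\<kappa> fixed_syndrome_leader)
        have "syndrome ?b k \<doteq> 0" if k: "k < c - 1" for k
        proof -
          have "syndrome ?b k \<doteq> s k - - t k"
            unfolding syndrome_diff s_def using leader[OF t(1) k] by (intro eqv_diff) auto
          also have "\<dots> = s k + t k" by simp
          also have "\<dots> \<doteq> s k + - s k" using t(2)[OF k] by (intro eqv_add) auto
          finally show ?thesis by simp
        qed
        then have x: "word ?b \<in> codewords" using fb by (intro word_in_codewords)
        have "y = word (?a (word ?b, t))"
        proof (rule qwords_eqI[OF y])
          show "word (?a (word ?b, t)) \<in> qwords q N" using fx word_in_qwords by blast
          fix i assume i: "i < N"
          have "\<kappa> (y i) = ?b i + syndrome_leader (lift t) i" by simp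
          also have "\<dots> \<doteq> \<kappa> (word ?b i) + syndrome_leader (lift t) i"
            using \<kappa>_word[of ?b i] fb i eqv_sym by (intro eqv_add) blast+
          also have "\<dots> \<doteq> \<kappa> (word (?a (word ?b, t)) i)"
            using eqv_sym[OF kw[OF i, of "(word ?b, t)"]] by simp
          finally show "\<kappa> (y i) \<doteq> \<kappa> (word (?a (word ?b, t)) i)" .
        qed
        then show "y \<in> (\<lambda>u. word (?a u)) ` (codewords \<times> messages)" using x t(1) by blast
      qed
    qed
  qed
  then have "card (codewords \<times> messages) = card (qwords q N)" by (rule bij_betw_same_card)
  then show ?thesis by (simp add: card_cartesian_product card_messages qwords_def card_PiE)
qed

section \<open>The two Knill-Laflamme conditions for the trace code\<close>

text \<open>The difference of two codewords has zero syndromes. A polynomial of degree at most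
  \<open>c - 2\<close> that is 1 at one position of \<open>S\<close> and 0 at the others isolates
  the weighted entry there as a combination of syndromes.\<close>

lemma separated:
  assumes S: "S \<subseteq> {..<N}" "card S < c" and xy: "x \<in> codewords" "y \<in> codewords" "\<forall>i\<in>{..<N} - S. x i = y i"
  shows "x = y"
proof (rule qwords_eqI)
  show "x \<in> qwords q N" "y \<in> qwords q N" using xy by (auto simp: codewords_def)
  have finS: "finite S" using S(1) finite_subset by blast
  define d where "d i = \<kappa> (x i) - \<kappa> (y i)" for i
  fix i assume i: "i < N"
  show "\<kappa> (x i) \<doteq> \<kappa> (y i)"
  proof (cases "i \<in> S")
    case True
    have "card S \<le> c - 1" using S by simp
    then obtain f where f: "\<And>j. j \<in> S \<Longrightarrow> (\<Sum>l<c - 1. f l * z ^ (j * l)) \<doteq> (if j = i then 1 else 0)"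
      using interpolation_sum[OF S(1), of "c - 1" "\<lambda>j. if j = i then 1 else 0"] by blast
    have "(z ^ (q + 1)) ^ i * d i = (\<Sum>j\<in>S. if j = i then (z ^ (q + 1)) ^ j * d j else 0)"
      using True finS by simp
    also have "\<dots> = (\<Sum>j\<in>S. (z ^ (q + 1)) ^ j * d j * (if j = i then 1 else 0))"
      by (intro sum.cong) auto
    also have "\<dots> \<doteq> (\<Sum>j\<in>S. (z ^ (q + 1)) ^ j * d j * (\<Sum>l<c - 1. f l * z ^ (j * l)))"
      using f eqv_sym by (intro eqv_sum eqv_mult) auto
    also have "\<dots> = (\<Sum>j<N. (z ^ (q + 1)) ^ j * d j * (\<Sum>l<c - 1. f l * z ^ (j * l)))"
      using S(1) xy by (intro sum.mono_neutral_left) (auto simp: d_def)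
    also have "\<dots> = (\<Sum>l<c - 1. f l * syndrome d l)"
    proof -
      have "(z ^ (q + 1)) ^ j * d j * (f l * z ^ (j * l)) = f l * ((z ^ (q + 1 + l)) ^ j * d j)" for j l
      proof -
        have "(z ^ (q + 1 + l)) ^ j = (z ^ (q + 1)) ^ j * z ^ (j * l)"
          unfolding power_mult[symmetric] power_add[symmetric] by (simp add: algebra_simps)
        then show ?thesis by (simp only: mult_ac)
      qed
      then show ?thesis
        unfolding syndrome_def sum_distrib_left by (simp only:) (rule sum.swap)
    qed
    also have "\<dots> \<doteq> (\<Sum>l<c - 1. f l * (0 - 0))"
      unfolding d_def syndrome_diff using xy by (intro eqv_sum eqv_mult eqv_diff) (auto simp: codewords_def)
    finally have "(z ^ (q + 1)) ^ i * d i \<doteq> 0" by simp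
    then have "z ^ ((q + 1) * i) * d i \<doteq> 0" unfolding power_mult .
    then have "d i \<doteq> 0" using eqv_mult_0D not_power_eqv_0 by blast
    then show ?thesis by (simp add: d_def eqv_iff_diff[symmetric])
  next
    case False
    then show ?thesis using xy i by simp
  qed
qed

text \<open>Translation by \<open>x' - x\<close> plus a suitable trace word maps the first set
  injectively into the second. Exchanging the roles later gives equality, hence uniformity.\<close>

lemma class_restrict_le:
  assumes S: "S \<subseteq> {..<N}" "card S < c" and x: "x \<in> codewords" "x' \<in> codewords"
    and w: "w \<in> S \<rightarrow>\<^sub>E {..<q}" "w' \<in> S \<rightarrow>\<^sub>E {..<q}"
  shows "card {y \<in> coset_rel `` {x}. restrict y S = w} \<le> card {y \<in> coset_rel `` {x'}. restrict y S = w'}"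
proof -
  \<comment> \<open>What the trace word must add on \<open>S\<close> to reach \<open>w'\<close> from
    \<open>w\<close> after the translation by \<open>x' - x\<close>.\<close>
  define v where "v i = \<kappa> (w' i) - \<kappa> (w i) - \<kappa> (x' i) + \<kappa> (x i)" for i
  have "card S \<le> c - 1" using S by simp
  \<comment> \<open>Interpolating \<open>\<theta> * v\<close> works because its trace is
    \<open>v\<close>, whose entries lie in the subfield.\<close>
  then obtain f where f: "\<And>i. i \<in> S \<Longrightarrow> (\<Sum>l<c - 1. f l * z ^ (i * l)) \<doteq> \<theta> * v i"
    using interpolation_sum[OF S(1), of "c - 1" "\<lambda>i. \<theta> * v i"] by blast
  have fv: "trace_vec 1 f i \<doteq> v i" if "i \<in> S" for i
  proof -
    have "trace_vec 1 f i \<doteq> tr (\<theta> * v i)"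
      unfolding trace_vec_def using f[OF that] by (intro tr_cong) (simp add: power_mult)
    also have "\<dots> \<doteq> v i"
      unfolding v_def by (intro tr_\<theta> fixed_add fixed_diff fixed_\<kappa>)
    finally show ?thesis .
  qed
  let ?a = "\<lambda>y i. \<kappa> (y i) + (\<kappa> (x' i) - \<kappa> (x i) + trace_vec 1 f i)"
  have fx: "fixed (?a y i)" for y i by (intro fixed_add fixed_diff fixed_\<kappa> fixed_trace_vec)
  have kw: "\<kappa> (word (?a y) i) \<doteq> ?a y i" if "i < N" for y i
    using \<kappa>_word[of "?a y" i] fx that by blast
  show ?thesis
  proof (rule card_inj_on_le)
    show "finite {y \<in> coset_rel `` {x'}. restrict y S = w'}"
      by (rule finite_subset[of _ "qwords q N"]) (auto simp: coset_rel_def codewords_def)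
    show "inj_on (\<lambda>y. word (?a y)) {y \<in> coset_rel `` {x}. restrict y S = w}"
    proof (rule inj_onI)
      fix y1 y2 assume y: "y1 \<in> {y \<in> coset_rel `` {x}. restrict y S = w}" "y2 \<in> {y \<in> coset_rel `` {x}. restrict y S = w}"
        "word (?a y1) = word (?a y2)"
      show "y1 = y2"
      proof (rule qwords_eqI)
        show "y1 \<in> qwords q N" "y2 \<in> qwords q N" using y by (auto simp: coset_rel_def codewords_def)
        fix i assume i: "i < N"
        have "?a y1 i \<doteq> ?a y2 i"
          using eqv_trans[OF eqv_sym[OF kw[OF i, of y1]]] kw[OF i, of y2] y(3) by simp
        then show "\<kappa> (y1 i) \<doteq> \<kappa> (y2 i)"
          by (simp only: eqv_add_left_cancel add.commute[of "\<kappa> (y1 i)"] add.commute[of "\<kappa> (y2 i)"])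
      qed
    qed
    show "(\<lambda>y. word (?a y)) ` {y \<in> coset_rel `` {x}. restrict y S = w} \<subseteq> {y \<in> coset_rel `` {x'}. restrict y S = w'}"
    proof (rule image_subsetI)
      fix y assume "y \<in> {y \<in> coset_rel `` {x}. restrict y S = w}"
      then have y: "(x, y) \<in> coset_rel" "w = restrict y S" by auto
      then obtain g where g: "\<forall>i<N. \<kappa> (y i) - \<kappa> (x i) \<doteq> trace_vec 1 g i" by (auto simp: coset_rel_def)
      let ?h = "\<lambda>l. g l + f l"
      have "word (?a y) = word (\<lambda>i. \<kappa> (x' i) + trace_vec 1 ?h i)"
      proof (rule qwords_eqI)
        have fh: "fixed (\<kappa> (x' i) + trace_vec 1 ?h i)" for i by (intro fixed_add fixed_\<kappa> fixed_trace_vec)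
        show "word (?a y) \<in> qwords q N" "word (\<lambda>i. \<kappa> (x' i) + trace_vec 1 ?h i) \<in> qwords q N"
          by (intro word_in_qwords fx fh)+
        fix i assume i: "i < N"
        have "\<kappa> (word (?a y) i) \<doteq> ?a y i" by (rule kw[OF i])
        also have "\<dots> = \<kappa> (x' i) + ((\<kappa> (y i) - \<kappa> (x i)) + trace_vec 1 f i)" by simp
        also have "\<dots> \<doteq> \<kappa> (x' i) + (trace_vec 1 g i + trace_vec 1 f i)"
          using g i by (intro eqv_add) auto
        also have "\<dots> \<doteq> \<kappa> (x' i) + trace_vec 1 ?h i"
          using eqv_sym[OF trace_vec_add] by (intro eqv_add) auto
        also have "\<dots> \<doteq> \<kappa> (word (\<lambda>i. \<kappa> (x' i) + trace_vec 1 ?h i) i)"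
          using \<kappa>_word[of "\<lambda>i. \<kappa> (x' i) + trace_vec 1 ?h i" i] fh i eqv_sym by blast
        finally show "\<kappa> (word (?a y) i) \<doteq> \<kappa> (word (\<lambda>i. \<kappa> (x' i) + trace_vec 1 ?h i) i)" .
      qed
      then have mem: "(x', word (?a y)) \<in> coset_rel" using translate_in_coset_rel[OF x(2), of ?h] by simp
      moreover have "restrict (word (?a y)) S = w'"
      proof (rule extensionalityI)
        show "restrict (word (?a y)) S \<in> extensional S" "w' \<in> extensional S" using w by (auto simp: PiE_iff)
        fix i assume i: "i \<in> S"
        then have iN: "i < N" using S by auto
        have "\<kappa> (word (?a y) i) \<doteq> ?a y i" by (rule kw[OF iN])
        also have "\<dots> \<doteq> \<kappa> (y i) + (\<kappa> (x' i) - \<kappa> (x i) + v i)" using fv[OF i] by (intro eqv_add) auto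
        also have "\<dots> = \<kappa> (w' i)" using i y by (simp add: v_def)
        finally have "\<kappa> (word (?a y) i) \<doteq> \<kappa> (w' i)" .
        moreover have "word (?a y) i < q" using mem iN by (auto simp: coset_rel_def codewords_def qwords_def PiE_iff)
        moreover have "w' i < q" using w i by auto
        ultimately show "restrict (word (?a y)) S i = w' i" using \<kappa>_inj i by simp
      qed
      ultimately show "word (?a y) \<in> {y \<in> coset_rel `` {x'}. restrict y S = w'}" by simp
    qed
  qed
qed

text \<open>The dimension is the number of cosets of D in C. Both the size of D and the index of C
  are \<open>q ^ (2 * c - 3)\<close>, which leaves the exponent
  \<open>N - 2 * (2 * c - 3)\<close>.\<close>

lemma quantum_code_trace_code: "quantum_code q N (q\<^sup>2 - 4 * c + 5) c (coset_states codewords coset_rel)"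
proof (rule coset_quantum_code[OF _ equiv_coset_rel])
  show CN: "codewords \<subseteq> qwords q N" by (auto simp: codewords_def)
  show "x = y" if "S \<subseteq> {..<N}" "card S < c" "x \<in> codewords" "y \<in> codewords" "\<forall>i\<in>{..<N} - S. x i = y i" for S x y
    using that by (rule separated)
  show "\<exists>\<mu>. \<forall>x\<in>codewords. \<forall>w\<in>S \<rightarrow>\<^sub>E {..<q}. card {y \<in> coset_rel `` {x}. restrict y S = w} = \<mu>"
    if S: "S \<subseteq> {..<N}" "card S < c" for S
    using class_restrict_le[OF S] by (meson order_antisym)
  show card: "card (coset_rel `` {x}) = q ^ (2 * c - 3)" if "x \<in> codewords" for x using that by (rule card_class)
  show "card (codewords // coset_rel) = q ^ (q\<^sup>2 - 4 * c + 5)"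
  proof -
    have "finite codewords" by (rule finite_subset[OF CN finite_qwords])
    then have "card codewords = q ^ (2 * c - 3) * card (codewords // coset_rel)"
      using card_eq_card_quotient_times[OF _ equiv_coset_rel card] by blast
    then have "card (codewords // coset_rel) * q ^ ((2 * c - 3) + (2 * c - 3)) = q ^ N"
      unfolding card_codewords[symmetric] power_add by (simp only: mult_ac)
    moreover have "N = (q\<^sup>2 - 4 * c + 5) + ((2 * c - 3) + (2 * c - 3))"
    proof -
      \<comment> \<open>Keeps the subtraction in the exponent from truncating; \<open>q = 3\<close>
        forces \<open>c = 2\<close>.\<close>
      have "4 * c \<le> q\<^sup>2"
      proof (cases "q = 3")
        case False
        then have "4 * c \<le> q * q" using q_ge_3 c by (intro mult_mono) auto
        then show ?thesis by (simp add: power2_eq_square)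
      qed (use c in simp)
      then show ?thesis using c by linarith
    qed
    ultimately have "card (codewords // coset_rel) * q ^ ((2 * c - 3) + (2 * c - 3))
        = q ^ (q\<^sup>2 - 4 * c + 5) * q ^ ((2 * c - 3) + (2 * c - 3))"
      by (metis power_add)
    then show ?thesis using q_ge_3 by (simp only: mult_cancel2 power_eq_0_iff) linarith
  qed
qed

end

theorem corollary4p1:
  fixes q c :: nat
  assumes "primepow q" and "q \<ge> 3" and "2 \<le> c" and "c < q"
  shows "\<exists>Q. quantum_code q (q\<^sup>2 - 1) (q\<^sup>2 - 4 * c + 5) c Q"
proof -
  obtain p e where p: "Factorial_Ring.prime p" and e: "e > 0" "q = p ^ e"
    using assms(1) by (auto simp: primepow_def)
  then obtain M :: "int poly set" and z where "galois_residues M z (p ^ (2 * e)) p (2 * e)"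
    using exists_galois_residues[of p "2 * e"] by auto
  moreover have "p ^ (2 * e) = q\<^sup>2" using e by (simp add: power_even_eq)
  ultimately interpret galois_residues M z "q\<^sup>2" p "2 * e" by simp
  interpret trace_code M z q p e c
    using e assms by unfold_locales auto
  show ?thesis using quantum_code_trace_code by blast
qed

end
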